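(* Let $q,N\ge1$ be integers, let $r_1,\dots,r_N\ge0$ and $t>0$, and let $G\in\mathbb R^{q\times N}$ have columns $g_1,\dots,g_N$. For $K>0$ put $$S=\frac1N\sum_{j=1}^N r_jg_jg_j^{\mathsf T},\qquad S^K=\frac1N\sum_{j:\,r_j\le K}r_jg_jg_j^{\mathsf T}.$$ Fix $M>0$, write $\mathcal I=\{j:r_j>M\}$, and suppose that $|\mathcal I|\le q$ and that the submatrix $G_{\mathcal I}$ of $G$ with columns indexed by $\mathcal I$ has full column rank when $\mathcal I\ne\varnothing$. Let $$C_0=I+\frac1{Nt}\sum_{j:\,r_j\le M}r_jg_jg_j^{\mathsf T},\qquad\overline\varsigma=\max\{1,\|G\|^2/(Nt)\},\qquad\underline\varsigma=\min\{1,\,s_{\min}(G_{\mathcal I})^2/(Nt\|C_0\|)\},$$ with $\underline\varsigma=1$ if $\mathcal I=\varnothing$. For $K\ge M$, let $k=\#\{j:r_j>K\}$ and let $\lambda_1(S)\ge\dots\ge\lambda_q(S)$ be the eigenvalues of $S$ in decreasing order. Then $$0\le\log\det(I+S^K/t)-\sum_{i=k+1}^q\log(1+\lambda_i(S)/t)\le k\log(\overline\varsigma/\underline\varsigma).$$ In particular, the bound has no dependence on $\max_jr_j$.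
   Context: $\|\cdot\|$ is the operator norm; $s_{\min}(G_{\mathcal I})$ is the smallest singular value of the $q\times|\mathcal I|$ matrix $G_{\mathcal I}$ (i.e. $s_{\min}(G_{\mathcal I})^2$ is the smallest eigenvalue of $G_{\mathcal I}^{\mathsf T}G_{\mathcal I}$). *)

theory Defs
  imports
    Complex_Main
    "HOL-Library.Multiset"
    "HOL-Computational_Algebra.Polynomial"
    "Jordan_Normal_Form.Char_Poly"
    "Jordan_Normal_Form.DL_Rank"
    "Jordan_Normal_Form.DL_Submatrix"
begin

text \<open>
  Matrices and vectors are the dimension-carrying ones of the Jordan normal form library, so the
  columns of \<open>G\<close> and the weights \<open>r\<close> are indexed by \<open>0, ..., N - 1\<close>.
\<close>

definition l2_norm :: "real vec \<Rightarrow> real" where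
  "l2_norm v = sqrt (v \<bullet> v)"

definition op_norm :: "real mat \<Rightarrow> real" where
  "op_norm A = (SUP v\<in>{v \<in> carrier_vec (dim_col A). l2_norm v \<le> 1}. l2_norm (A *\<^sub>v v))"

text \<open>Only meaningful for at least one column, since otherwise the set of eigenvalues is empty.\<close>

definition s_min :: "real mat \<Rightarrow> real" where
  "s_min A = sqrt (Min {e. eigenvalue (transpose_mat A * A) e})"

text \<open>
  The real eigenvalues in decreasing order, repeated according to their multiplicity as roots of
  the characteristic polynomial and numbered from 1. For a symmetric real matrix of dimension \<open>q\<close>
  the underlying list has length \<open>q\<close>.
\<close>

definition eig_desc :: "real mat \<Rightarrow> nat \<Rightarrow> real" where
  "eig_desc A i = rev (sorted_list_of_multiset (proots (char_poly A))) ! (i - 1)"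

text \<open>The sum over \<open>j \<in> J\<close> of \<open>r\<^sub>j g\<^sub>j g\<^sub>j\<^sup>T\<close>, where \<open>g\<^sub>j\<close> is column \<open>j\<close> of \<open>G\<close>.\<close>

definition weighted_gram :: "real mat \<Rightarrow> (nat \<Rightarrow> real) \<Rightarrow> nat set \<Rightarrow> real mat" where
  "weighted_gram G r J =
     mat (dim_row G) (dim_row G) (\<lambda>(a, b). \<Sum>j\<in>J. r j * (col G j $ a * col G j $ b))"

definition S_full :: "real mat \<Rightarrow> (nat \<Rightarrow> real) \<Rightarrow> real mat" where
  "S_full G r = (1 / real (dim_col G)) \<cdot>\<^sub>m weighted_gram G r {j. j < dim_col G}"

definition S_trunc :: "real mat \<Rightarrow> (nat \<Rightarrow> real) \<Rightarrow> real \<Rightarrow> real mat" where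
  "S_trunc G r K = (1 / real (dim_col G)) \<cdot>\<^sub>m weighted_gram G r {j. j < dim_col G \<and> r j \<le> K}"

definition large_idx :: "nat \<Rightarrow> (nat \<Rightarrow> real) \<Rightarrow> real \<Rightarrow> nat set" where
  "large_idx N r K = {j. j < N \<and> r j > K}"

definition G_large :: "real mat \<Rightarrow> (nat \<Rightarrow> real) \<Rightarrow> real \<Rightarrow> real mat" where
  "G_large G r M = submatrix G UNIV (large_idx (dim_col G) r M)"

definition C0 :: "real mat \<Rightarrow> (nat \<Rightarrow> real) \<Rightarrow> real \<Rightarrow> real \<Rightarrow> real mat" where
  "C0 G r t M = 1\<^sub>m (dim_row G) +
     (1 / (real (dim_col G) * t)) \<cdot>\<^sub>m weighted_gram G r {j. j < dim_col G \<and> r j \<le> M}"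

definition sigma_upper :: "real mat \<Rightarrow> real \<Rightarrow> real" where
  "sigma_upper G t = max 1 ((op_norm G)\<^sup>2 / (real (dim_col G) * t))"

definition sigma_lower :: "real mat \<Rightarrow> (nat \<Rightarrow> real) \<Rightarrow> real \<Rightarrow> real \<Rightarrow> real" where
  "sigma_lower G r t M =
     (if large_idx (dim_col G) r M = {} then 1
      else min 1 ((s_min (G_large G r M))\<^sup>2 / (real (dim_col G) * t * op_norm (C0 G r t M))))"

end

theory Submission
  imports Defs "Jordan_Normal_Form.Schur_Decomposition"
begin

text \<open>
  Write \<open>A = I + S\<^sup>K/t\<close> and \<open>B = I + S/t\<close>, so that \<open>B - A\<close> is a nonnegative combination of \<open>k\<close>
  rank-one matrices \<open>g\<^sub>j g\<^sub>j\<^sup>T\<close> with \<open>r\<^sub>j > K\<close>. Weyl's inequality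
  \<open>\<lambda>\<^sub>i\<^sub>+\<^sub>k(B) \<le> \<lambda>\<^sub>i(A)\<close> gives the lower bound. For the upper bound, the top \<open>k\<close> eigenvalues of \<open>B\<close>
  are compared with \<open>det B / det A\<close>. Weyl's inequality again, removing the columns with the largest
  weights one by one, bounds the product of the top \<open>k\<close> eigenvalues by the product of
  \<open>sigma_upper (1 + r\<^sub>j)\<close>. Conversely every rank-one update \<open>c g g\<^sup>T\<close> of a positive definite \<open>Q\<close>
  multiplies the determinant by \<open>1 + c g\<^sup>T Q\<^sup>-\<^sup>1 g \<ge> 1 + c / (x\<^sup>T Q x)\<close> for every \<open>x\<close> with \<open>g\<^sup>T x = 1\<close>.
  Taking for \<open>x\<close> the dual vector of \<open>g\<^sub>j\<close> in the column space of \<open>G\<^sub>I\<close> makes all the other heavy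
  terms of \<open>Q\<close> vanish, so that \<open>x\<^sup>T Q x \<le> x\<^sup>T C\<^sub>0 x \<le> op_norm C\<^sub>0 / s_min\<^sup>2\<close>, and the factor is at least
  \<open>sigma_lower (1 + r\<^sub>j)\<close>. The weights cancel.
\<close>

section \<open>Orthogonal diagonalization of real symmetric matrices\<close>

lemma scalar_prod_self_ge_0: "0 \<le> v \<bullet> v" for v :: "real vec"
  using conjugate_square_ge_0_vec[of v] by simp

lemma scalar_prod_self_eq_0_iff: "v \<in> carrier_vec n \<Longrightarrow> v \<bullet> v = 0 \<longleftrightarrow> v = 0\<^sub>v n" for v :: "real vec"
  using conjugate_square_eq_0_vec[of v n] by simp

lemma scalar_prod_self_pos: "v \<in> carrier_vec n \<Longrightarrow> v \<noteq> 0\<^sub>v n \<Longrightarrow> 0 < v \<bullet> v" for v :: "real vec"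
  using conjugate_square_greater_0_vec[of v n] by simp

lemma symmetric_scalar_prod:
  fixes A :: "'a :: comm_semiring_0 mat"
  assumes "A \<in> carrier_mat n n" "transpose_mat A = A" "x \<in> carrier_vec n" "y \<in> carrier_vec n"
  shows "(A *\<^sub>v x) \<bullet> y = x \<bullet> (A *\<^sub>v y)"
  using transpose_vec_mult_scalar[of A n n y x] assms by simp

text \<open>Pairing an eigenvector \<open>v\<close> with its conjugate and moving the real symmetric
  matrix across gives \<open>a = conjugate a\<close>. The product \<open>\<bullet>\<close> is
  bilinear, so the squared Hermitian norm is \<open>v \<bullet> conjugate v\<close>.\<close>

lemma symmetric_real_char_poly_root_real:
  fixes A :: "real mat" and a :: complex
  assumes A: "A \<in> carrier_mat n n" and sym: "transpose_mat A = A"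
    and root: "poly (char_poly (map_mat complex_of_real A)) a = 0"
  shows "a \<in> \<real>"
proof -
  let ?C = "map_mat complex_of_real A"
  have C: "?C \<in> carrier_mat n n" using A by simp
  have "eigenvalue ?C a" using root eigenvalue_root_char_poly[OF C] by simp
  then obtain v where v: "v \<in> carrier_vec n" and v0: "v \<noteq> 0\<^sub>v n" and ev: "?C *\<^sub>v v = a \<cdot>\<^sub>v v"
    using C by (auto simp: eigenvalue_def eigenvector_def)
  have symC: "transpose_mat ?C = ?C"
    by (metis map_mat_transpose sym)
  have cv: "conjugate v \<in> carrier_vec n" using v by simp
  have "conjugate (?C *\<^sub>v v) = ?C *\<^sub>v conjugate v"
  proof (rule eq_vecI)
    fix i assume "i < dim_vec (?C *\<^sub>v conjugate v)"
    hence i: "i < n" using C by simp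
    have r: "conjugate (row ?C i) = row ?C i"
      using i A by (intro eq_vecI) auto
    have "conjugate (row ?C i \<bullet> v) = conjugate (row ?C i) \<bullet> conjugate v"
      using conjugate_sprod_vec[of "row ?C i" n v] v C i by auto
    thus "conjugate (?C *\<^sub>v v) $ i = (?C *\<^sub>v conjugate v) $ i"
      using i C r A by simp
  qed (use C in auto)
  hence ev': "?C *\<^sub>v conjugate v = conjugate a \<cdot>\<^sub>v conjugate v"
    using ev by (simp add: conjugate_smult_vec)
  have "a * (v \<bullet> conjugate v) = (?C *\<^sub>v v) \<bullet> conjugate v"
    using ev v cv by simp
  also have "\<dots> = v \<bullet> (?C *\<^sub>v conjugate v)"
    by (rule symmetric_scalar_prod[OF C symC v cv])
  also have "\<dots> = conjugate a * (v \<bullet> conjugate v)"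
    using ev' v cv by simp
  finally have "a = conjugate a"
    using conjugate_square_eq_0_vec[OF v] v0 by simp
  thus ?thesis by (simp add: complex_is_Real_iff complex_eq_iff)
qed

text \<open>The characteristic polynomial splits over the complex numbers and all its roots are
  real, so the factorization descends along the injective map
  \<open>map_poly complex_of_real\<close>.\<close>

lemma symmetric_real_char_poly_splits:
  fixes A :: "real mat"
  assumes A: "A \<in> carrier_mat n n" and sym: "transpose_mat A = A"
  shows "\<exists>es. char_poly A = (\<Prod>e\<leftarrow>es. [:- e, 1:]) \<and> length es = n"
proof -
  interpret c: map_poly_inj_idom_hom complex_of_real ..
  let ?C = "map_mat complex_of_real A"
  have C: "?C \<in> carrier_mat n n" using A by simp
  obtain as where as: "char_poly ?C = (\<Prod>a\<leftarrow>as. [:- a, 1:])" "length as = n"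
    using char_poly_factorized[OF C] by blast
  have real: "a \<in> \<real>" if "a \<in> set as" for a
  proof (rule symmetric_real_char_poly_root_real[OF A sym])
    show "poly (char_poly ?C) a = 0"
      using that by (force simp: as poly_prod_list_zero_iff)
  qed
  have "map_poly complex_of_real (char_poly A) = char_poly ?C"
    by (rule of_real_hom.char_poly_hom[OF A, symmetric])
  also have "\<dots> = (\<Prod>a\<leftarrow>as. map_poly complex_of_real [:- Re a, 1:])"
    unfolding as using real by (intro arg_cong[where f = prod_list] map_cong refl) (simp add: hom_distribs)
  also have "\<dots> = map_poly complex_of_real (\<Prod>a\<leftarrow>as. [:- Re a, 1:])"
    by (induction as) (auto simp: hom_distribs)
  finally have "char_poly A = (\<Prod>a\<leftarrow>as. [:- Re a, 1:])"
    by simp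
  thus ?thesis
    using as(2) by (intro exI[of _ "map Re as"]) (simp add: o_def)
qed

text \<open>Completing \<open>v\<close> to a basis and applying Gram-Schmidt keeps \<open>v\<close>
  in front; the normalized vectors are the columns. Such a matrix splits off one eigenvector in the
  diagonalization below.\<close>

lemma exists_orthogonal_mat_first_col:
  fixes v :: "real vec"
  assumes v: "v \<in> carrier_vec n" and v0: "v \<noteq> 0\<^sub>v n"
  obtains W where "W \<in> carrier_mat n n" "transpose_mat W * W = 1\<^sub>m n"
    "col W 0 = (1 / sqrt (v \<bullet> v)) \<cdot>\<^sub>v v"
proof -
  interpret cof_vec_space n "TYPE(real)" .
  define b where "b = basis_completion v"
  define ws where "ws = gram_schmidt n b"
  from basis_completion[OF v v0, folded b_def]
  have b: "set b \<subseteq> carrier_vec n" "distinct b" "\<not> lin_dep (set b)" "hd b = v" "length b = n"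
    by auto
  have n: "n \<noteq> 0" using v v0 by (metis zero_vec_zero carrier_vecD eq_vecI index_zero_vec(2) less_nat_zero_code)
  with b obtain vs where bv: "b = v # vs" by (cases b) auto
  from gram_schmidt_result[OF b(1-3) refl, folded ws_def] b
  have ws: "set ws \<subseteq> carrier_vec n" "corthogonal ws" "length ws = n" by auto
  have hd: "hd ws = v" using gram_schmidt_hd[OF v, of vs, folded bv] by (simp add: ws_def)
  hence ws0: "ws ! 0 = v" using ws(3) n by (cases ws) auto
  have wsi: "ws ! i \<in> carrier_vec n" if "i < n" for i using ws that by auto
  \<comment> \<open>The case \<open>i = j\<close> says that no vector of \<open>ws\<close> has norm
    zero, which makes the normalization legitimate.\<close>
  have orth: "ws ! i \<bullet> ws ! j = 0 \<longleftrightarrow> i \<noteq> j" if "i < n" "j < n" for i j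
    using corthogonalD[OF ws(2), of i j] ws(3) that by simp
  define W where "W = mat_of_cols n (map (\<lambda>w. (1 / sqrt (w \<bullet> w)) \<cdot>\<^sub>v w) ws)"
  have W: "W \<in> carrier_mat n n" using mat_of_cols_carrier(1)[of n] ws(3) by (metis W_def length_map)
  have colW: "col W i = (1 / sqrt (ws ! i \<bullet> ws ! i)) \<cdot>\<^sub>v ws ! i" if "i < n" for i
    unfolding W_def using that ws(3) wsi[OF that] by (subst col_mat_of_cols) auto
  show thesis
  proof (rule that)
    show "W \<in> carrier_mat n n" by (fact W)
    show "col W 0 = (1 / sqrt (v \<bullet> v)) \<cdot>\<^sub>v v" using colW[of 0] n ws0 by simp
    show "transpose_mat W * W = 1\<^sub>m n"
    proof (rule eq_matI)
      fix i j assume "i < dim_row (1\<^sub>m n :: real mat)" "j < dim_col (1\<^sub>m n :: real mat)"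
      hence ij: "i < n" "j < n" by auto
      have "(transpose_mat W * W) $$ (i, j) = col W i \<bullet> col W j" using W ij by simp
      also have "\<dots> = (1 / sqrt (ws ! i \<bullet> ws ! i)) * ((1 / sqrt (ws ! j \<bullet> ws ! j)) * (ws ! i \<bullet> ws ! j))"
        by (simp only: colW[OF ij(1)] colW[OF ij(2)] smult_scalar_prod_distrib[OF wsi[OF ij(1)] smult_carrier_vec[THEN iffD2, OF wsi[OF ij(2)]]]
            scalar_prod_smult_distrib[OF wsi[OF ij(1)] wsi[OF ij(2)]])
      also have "\<dots> = 1\<^sub>m n $$ (i, j)"
        using orth[OF ij] orth[OF ij(1) ij(1)] ij scalar_prod_self_ge_0[of "ws ! i"]
        by (auto simp: field_simps)
      finally show "(transpose_mat W * W) $$ (i, j) = 1\<^sub>m n $$ (i, j)" .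
    qed (use W in auto)
  qed
qed

lemma orthogonal_mat_right_inverse:
  fixes P :: "real mat"
  assumes "P \<in> carrier_mat n n" "transpose_mat P * P = 1\<^sub>m n"
  shows "P * transpose_mat P = 1\<^sub>m n"
  using mat_mult_left_right_inverse[of "transpose_mat P" n P] assms by auto

lemma orthogonal_conjugate_similar:
  fixes P :: "real mat"
  assumes A: "A \<in> carrier_mat n n" and P: "P \<in> carrier_mat n n" "transpose_mat P * P = 1\<^sub>m n"
  shows "similar_mat (transpose_mat P * A * P) A"
  unfolding similar_mat_def
  by (intro exI[of _ "transpose_mat P"] exI[of _ P] similar_mat_witI[of _ _ n])
    (use assms orthogonal_mat_right_inverse[OF P] in auto)

text \<open>Deflation by induction on the list of roots: conjugation by \<open>W\<close> splits off
  \<open>e\<close>, and the complementary block has the remaining roots. Taking the list as a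
  parameter prescribes the order of the diagonal entries, which is later chosen decreasing.\<close>

theorem symmetric_orthogonal_diagonalization:
  fixes A :: "real mat"
  assumes "A \<in> carrier_mat n n" "transpose_mat A = A"
    and "char_poly A = (\<Prod>e\<leftarrow>es. [:- e, 1:])"
  shows "\<exists>P. P \<in> carrier_mat n n \<and> transpose_mat P * P = 1\<^sub>m n \<and>
    transpose_mat P * A * P = mat_diag n (nth es)"
  using assms
proof (induction es arbitrary: n A)
  case Nil
  hence "n = 0" using degree_monic_char_poly[of A n] by simp
  thus ?case using Nil by (intro exI[of _ "1\<^sub>m 0"]) (auto simp: mat_diag_def intro!: eq_matI)
next
  case (Cons e es n A)
  note A = Cons.prems(1) and sym = Cons.prems(2)
  have e: "eigenvalue A e"
    unfolding eigenvalue_root_char_poly[OF A] Cons.prems(3) by simp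
  then obtain v where v: "v \<in> carrier_vec n" and v0: "v \<noteq> 0\<^sub>v n" and ev: "A *\<^sub>v v = e \<cdot>\<^sub>v v"
    using A by (auto simp: eigenvalue_def eigenvector_def)
  obtain m where n: "n = Suc m"
    using v v0 by (cases n) auto
  obtain W where W: "W \<in> carrier_mat n n" and WW: "transpose_mat W * W = 1\<^sub>m n"
    and W0: "col W 0 = (1 / sqrt (v \<bullet> v)) \<cdot>\<^sub>v v"
    using exists_orthogonal_mat_first_col[OF v v0] by blast
  define B where "B = transpose_mat W * A * W"
  have B: "B \<in> carrier_mat n n" using A W by (simp add: B_def)
  have symB: "transpose_mat B = B"
    unfolding B_def using A W sym
    by (simp add: transpose_mult[of _ n n _ n] assoc_mult_mat[of _ n n _ n _ n])
  have AW0: "A *\<^sub>v col W 0 = e \<cdot>\<^sub>v col W 0"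
    unfolding W0 using A v ev by (simp add: mult_mat_vec smult_smult_assoc mult.commute)
  have B0: "B $$ (i, 0) = (if i = 0 then e else 0)" if i: "i < n" for i
  proof -
    have "B $$ (i, 0) = (transpose_mat W * (A * W)) $$ (i, 0)"
      using A W by (simp add: B_def assoc_mult_mat[of _ n n _ n _ n])
    also have "\<dots> = col W i \<bullet> (A *\<^sub>v col W 0)"
      using col_mult2[OF A W, of 0] A W i n by simp
    also have "\<dots> = e * (transpose_mat W * W) $$ (i, 0)"
      unfolding AW0 using W i n by (simp add: scalar_prod_smult_distrib[of _ n])
    finally show ?thesis using i n by (simp add: WW)
  qed
  have B0': "B $$ (0, i) = (if i = 0 then e else 0)" if i: "i < n" for i
    using B0[OF i] B i n symB by (metis carrier_matD index_transpose_mat(1) zero_less_Suc)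
  define A' where "A' = mat m m (\<lambda>(i, j). B $$ (Suc i, Suc j))"
  have A': "A' \<in> carrier_mat m m" by (simp add: A'_def)
  have symA': "transpose_mat A' = A'"
  proof (rule eq_matI)
    fix i j assume "i < dim_row A'" "j < dim_col A'"
    hence ij: "i < m" "j < m" using A' by auto
    have "B $$ (Suc i, Suc j) = transpose_mat B $$ (Suc i, Suc j)" by (simp add: symB)
    thus "transpose_mat A' $$ (i, j) = A' $$ (i, j)"
      using ij B n by (simp add: A'_def)
  qed (use A' in auto)
  \<comment> \<open>The first column of \<open>W\<close> is an eigenvector, which clears the first
    column of \<open>B\<close> below the corner; symmetry clears the first row.\<close>
  have Bblock: "B = four_block_mat (mat 1 1 (\<lambda>_. e)) (0\<^sub>m 1 m) (0\<^sub>m m 1) A'"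
    using B n B0 B0' by (intro eq_matI) (auto simp: A'_def)
  have "char_poly A = char_poly B"
    using char_poly_similar[OF orthogonal_conjugate_similar[OF A W WW]] by (simp add: B_def)
  also have "\<dots> = char_poly (mat 1 1 (\<lambda>_. e)) * char_poly A'"
    unfolding Bblock by (rule char_poly_four_block_zeros_col[OF _ _ A']) auto
  also have "char_poly (mat 1 1 (\<lambda>_. e)) = [:- e, 1:]"
    by (simp add: char_poly_defs det_def sign_def)
  finally have "char_poly A' = (\<Prod>e\<leftarrow>es. [:- e, 1:])"
    using Cons.prems(3) by (metis (no_types, lifting) list.simps(9) mult_cancel_left
        pCons_eq_0_iff prod_list.Cons zero_neq_one)
  from Cons.IH[OF A' symA' this] obtain Q where Q: "Q \<in> carrier_mat m m"
    "transpose_mat Q * Q = 1\<^sub>m m" "transpose_mat Q * A' * Q = mat_diag m (nth es)"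
    by blast
  \<comment> \<open>\<open>R\<close> lets \<open>Q\<close> act on the complement of the eigenvector
    split off, so that \<open>W * R\<close> diagonalizes \<open>A\<close>.\<close>
  define R where "R = four_block_mat (1\<^sub>m 1) (0\<^sub>m 1 m) (0\<^sub>m m 1) Q"
  have R: "R \<in> carrier_mat n n" using four_block_carrier_mat[of "1\<^sub>m 1" 1 1 Q m m] Q n by (simp add: R_def)
  have RT: "transpose_mat R = four_block_mat (1\<^sub>m 1) (0\<^sub>m 1 m) (0\<^sub>m m 1) (transpose_mat Q)"
    unfolding R_def using Q by (subst transpose_four_block_mat) auto
  have RR: "transpose_mat R * R = 1\<^sub>m n"
    unfolding RT unfolding R_def n using Q
    by (subst mult_four_block_mat[of _ 1 1 _ m _ m _ _ 1 _ m]) auto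
  have RBR: "transpose_mat R * B * R = mat_diag n (nth (e # es))"
  proof -
    have "transpose_mat R * B = four_block_mat (mat 1 1 (\<lambda>_. e)) (0\<^sub>m 1 m) (0\<^sub>m m 1) (transpose_mat Q * A')"
      unfolding RT Bblock using Q A'
      by (subst mult_four_block_mat[of _ 1 1 _ m _ m _ _ 1 _ m]) auto
    hence "transpose_mat R * B * R =
        four_block_mat (mat 1 1 (\<lambda>_. e)) (0\<^sub>m 1 m) (0\<^sub>m m 1) (transpose_mat Q * A' * Q)"
      unfolding R_def using Q A'
      by (simp, subst mult_four_block_mat[of _ 1 1 _ m _ m _ _ 1 _ m]) auto
    also have "\<dots> = mat_diag n (nth (e # es))"
      unfolding Q(3) by (rule eq_matI) (auto simp: mat_diag_def n nth_Cons')
    finally show ?thesis .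
  qed
  show ?case
  proof (intro exI[of _ "W * R"] conjI)
    show "W * R \<in> carrier_mat n n" using W R by simp
    have "transpose_mat (W * R) * (W * R) = transpose_mat R * (transpose_mat W * W) * R"
      using W R by (simp add: transpose_mult[of _ n n _ n] assoc_mult_mat[of _ n n _ n _ n])
    thus "transpose_mat (W * R) * (W * R) = 1\<^sub>m n" using RR R by (simp add: WW)
    have "transpose_mat (W * R) * A * (W * R) = transpose_mat R * B * R"
      unfolding B_def using W R A
      by (simp add: transpose_mult[of _ n n _ n] assoc_mult_mat[of _ n n _ n _ n])
    thus "transpose_mat (W * R) * A * (W * R) = mat_diag n (nth (e # es))"
      using RBR by simp
  qed
qed

section \<open>Eigenvalues in decreasing order\<close>

text \<open>Passes from the multiset of roots to a decreasing list. Since \<open>eig_desc\<close>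
  counts from 1 and lists count from 0, the index \<open>Suc i\<close> absorbs the shift.\<close>

lemma symmetric_eig_desc_list:
  fixes A :: "real mat"
  assumes A: "A \<in> carrier_mat n n" and sym: "transpose_mat A = A"
  obtains es where "length es = n" "sorted_wrt (\<ge>) es" "char_poly A = (\<Prod>e\<leftarrow>es. [:- e, 1:])"
    "\<And>i. eig_desc A (Suc i) = es ! i"
proof -
  obtain fs where fs: "char_poly A = (\<Prod>e\<leftarrow>fs. [:- e, 1:])" "length fs = n"
    using symmetric_real_char_poly_splits[OF A sym] by blast
  have pr: "proots (char_poly A) = mset fs"
    unfolding fs(1)
  proof (induction fs)
    case (Cons e fs)
    have "(\<Prod>e\<leftarrow>fs. [:- e, 1:]) \<noteq> 0" by (auto simp: prod_list_zero_iff)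
    thus ?case using Cons by (simp add: proots_mult del: mult_pCons_left)
  qed simp
  have "mset (map (\<lambda>e. [:- e, 1:]) fs) = mset (map (\<lambda>e. [:- e, 1:]) (rev (sort fs)))"
    by simp
  hence "char_poly A = (\<Prod>e\<leftarrow>rev (sort fs). [:- e, 1:])"
    unfolding fs(1) by (metis prod_mset_prod_list)
  moreover have "sorted_wrt (\<ge>) (rev (sort fs))"
    by (simp add: sorted_wrt_rev)
  moreover have "eig_desc A (Suc i) = rev (sort fs) ! i" for i
    by (simp add: eig_desc_def pr sorted_list_of_multiset_mset)
  ultimately show thesis
    using that[of "rev (sort fs)"] fs(2) by simp
qed

lemma eig_desc_antimono:
  fixes A :: "real mat"
  assumes "A \<in> carrier_mat n n" "transpose_mat A = A" and "i \<le> j" "j < n"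
  shows "eig_desc A (Suc j) \<le> eig_desc A (Suc i)"
proof -
  obtain es where es: "length es = n" "sorted_wrt (\<ge>) es" "\<And>i. eig_desc A (Suc i) = es ! i"
    using symmetric_eig_desc_list[OF assms(1,2)] by metis
  show ?thesis
    using assms(3,4) es by (cases "i = j") (auto simp: sorted_wrt_iff_nth_less)
qed

text \<open>\<open>s_min\<close> is defined through the set of eigenvalues; written as a finite
  indexed family, this set has a minimum that can be compared with the spectral
  decomposition.\<close>

lemma eigenvalues_eq_eig_desc:
  fixes A :: "real mat"
  assumes A: "A \<in> carrier_mat n n" and "transpose_mat A = A"
  shows "{e. eigenvalue A e} = (\<lambda>i. eig_desc A (Suc i)) ` {..<n}"
proof -
  obtain es where es: "length es = n" "char_poly A = (\<Prod>e\<leftarrow>es. [:- e, 1:])"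
    "\<And>i. eig_desc A (Suc i) = es ! i"
    using symmetric_eig_desc_list[OF assms] by metis
  have "{e. eigenvalue A e} = set es"
    by (auto simp: eigenvalue_root_char_poly[OF A] es(2) poly_prod_list_zero_iff)
  thus ?thesis using es by (auto simp: set_conv_nth)
qed

lemma eig_desc_diagonalization:
  fixes A :: "real mat"
  assumes "A \<in> carrier_mat n n" "transpose_mat A = A"
  obtains P where "P \<in> carrier_mat n n" "transpose_mat P * P = 1\<^sub>m n" "P * transpose_mat P = 1\<^sub>m n"
    "transpose_mat P * A * P = mat_diag n (\<lambda>i. eig_desc A (Suc i))"
proof -
  obtain es where es: "length es = n" "char_poly A = (\<Prod>e\<leftarrow>es. [:- e, 1:])"
    "\<And>i. eig_desc A (Suc i) = es ! i"
    using symmetric_eig_desc_list[OF assms] by metis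
  show thesis
    using symmetric_orthogonal_diagonalization[OF assms es(2)] that orthogonal_mat_right_inverse
    by (auto simp: es(3))
qed

text \<open>The \<open>u i\<close> are the columns of the diagonalizing matrix, and the norm and the
  quadratic form are expressed in the coordinates \<open>u i \<bullet> x\<close>. The variational
  arguments use the spectral theorem in this form.\<close>

lemma eig_desc_eigenbasis:
  fixes A :: "real mat"
  assumes A: "A \<in> carrier_mat n n" and sym: "transpose_mat A = A"
  obtains u where "\<And>i. i < n \<Longrightarrow> u i \<in> carrier_vec n"
    "\<And>i j. i < n \<Longrightarrow> j < n \<Longrightarrow> u i \<bullet> u j = (if i = j then 1 else 0)"
    "\<And>x. x \<in> carrier_vec n \<Longrightarrow> x \<bullet> x = (\<Sum>i<n. (u i \<bullet> x)\<^sup>2)"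
    "\<And>x. x \<in> carrier_vec n \<Longrightarrow> x \<bullet> (A *\<^sub>v x) = (\<Sum>i<n. eig_desc A (Suc i) * (u i \<bullet> x)\<^sup>2)"
proof -
  obtain P where P: "P \<in> carrier_mat n n" and PP: "transpose_mat P * P = 1\<^sub>m n" "P * transpose_mat P = 1\<^sub>m n"
    and D: "transpose_mat P * A * P = mat_diag n (\<lambda>i. eig_desc A (Suc i))"
    using eig_desc_diagonalization[OF A sym] by blast
  let ?D = "mat_diag n (\<lambda>i. eig_desc A (Suc i))"
  show thesis
  proof (rule that[of "col P"])
    show "col P i \<in> carrier_vec n" if "i < n" for i using P by (metis carrier_matD(1) col_dim)
    show "col P i \<bullet> col P j = (if i = j then 1 else 0)" if "i < n" "j < n" for i j
    proof -
      have "col P i \<bullet> col P j = (transpose_mat P * P) $$ (i, j)" using P that by simp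
      thus ?thesis using that by (simp add: PP)
    qed
    fix x :: "real vec" assume x: "x \<in> carrier_vec n"
    define y where "y = transpose_mat P *\<^sub>v x"
    have y: "y \<in> carrier_vec n" using P x by (simp add: y_def)
    have yi: "y $ i = col P i \<bullet> x" if "i < n" for i using P that by (simp add: y_def)
    have xy: "x = P *\<^sub>v y"
      using P x by (simp add: y_def assoc_mult_mat_vec[of _ n n _ n, symmetric] PP del: assoc_mult_mat_vec)
    have "x \<bullet> x = (P *\<^sub>v y) \<bullet> x" by (simp add: xy[symmetric])
    also have "\<dots> = y \<bullet> y"
      using transpose_vec_mult_scalar[of P n n y x] P x y
      by (metis comm_scalar_prod mult_mat_vec_carrier transpose_carrier_mat y_def)
    finally show "x \<bullet> x = (\<Sum>i<n. (col P i \<bullet> x)\<^sup>2)"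
      using y by (simp add: scalar_prod_def[of y y] yi power2_eq_square atLeast0LessThan)
    have Ax: "transpose_mat P *\<^sub>v (A *\<^sub>v x) = ?D *\<^sub>v y"
      unfolding D[symmetric] xy using P A y
      by (simp add: assoc_mult_mat_vec[of _ n n _ n] assoc_mult_mat[of _ n n _ n _ n])
    have "x \<bullet> (A *\<^sub>v x) = (A *\<^sub>v x) \<bullet> (P *\<^sub>v y)"
      using A x comm_scalar_prod[of x n "A *\<^sub>v x"] by (simp add: xy[symmetric])
    also have "\<dots> = (?D *\<^sub>v y) \<bullet> y"
      using transpose_vec_mult_scalar[of P n n y "A *\<^sub>v x"] P A x y by (simp add: Ax)
    also have "\<dots> = (\<Sum>i<n. eig_desc A (Suc i) * (y $ i)\<^sup>2)"
    proof -
      have "(?D *\<^sub>v y) $ i = eig_desc A (Suc i) * y $ i" if i: "i < n" for i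
      proof -
        have "(?D *\<^sub>v y) $ i = (\<Sum>k<n. (if i = k then eig_desc A (Suc k) else 0) * y $ k)"
          using i y by (auto simp: mat_diag_def scalar_prod_def atLeast0LessThan intro!: sum.cong)
        also have "\<dots> = (\<Sum>k<n. if i = k then eig_desc A (Suc k) * y $ k else 0)"
          by (intro sum.cong) auto
        finally show ?thesis using i by simp
      qed
      thus ?thesis
        using y by (simp add: scalar_prod_def power2_eq_square atLeast0LessThan algebra_simps)
    qed
    finally show "x \<bullet> (A *\<^sub>v x) = (\<Sum>i<n. eig_desc A (Suc i) * (col P i \<bullet> x)\<^sup>2)"
      by (simp add: yi)
  qed
qed

text \<open>Conjugation by the orthogonal matrix of eigenvectors fixes the identity, diagonalizes
  \<open>A\<close> and preserves the determinant.\<close>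

lemma det_one_plus_smult_eig_desc:
  fixes A :: "real mat"
  assumes A: "A \<in> carrier_mat n n" and sym: "transpose_mat A = A"
  shows "Determinant.det (1\<^sub>m n + s \<cdot>\<^sub>m A) = (\<Prod>i<n. 1 + s * eig_desc A (Suc i))"
proof -
  obtain P where P: "P \<in> carrier_mat n n" and PP: "transpose_mat P * P = 1\<^sub>m n" "P * transpose_mat P = 1\<^sub>m n"
    and D: "transpose_mat P * A * P = mat_diag n (\<lambda>i. eig_desc A (Suc i))"
    using eig_desc_diagonalization[OF A sym] by blast
  have "transpose_mat P * (1\<^sub>m n + s \<cdot>\<^sub>m A) * P = transpose_mat P * P + s \<cdot>\<^sub>m (transpose_mat P * A * P)"
    using P A by (simp add: mult_add_distrib_mat[of _ n n _ n] add_mult_distrib_mat[of _ n n _ _ n]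
        mult_smult_distrib[of _ n n _ n] mult_smult_assoc_mat[of _ n n _ n])
  also have "\<dots> = mat_diag n (\<lambda>i. 1 + s * eig_desc A (Suc i))"
    unfolding PP D by (rule eq_matI) (auto simp: mat_diag_def)
  finally have eq: "transpose_mat P * (1\<^sub>m n + s \<cdot>\<^sub>m A) * P = mat_diag n (\<lambda>i. 1 + s * eig_desc A (Suc i))" .
  have "similar_mat (transpose_mat P * (1\<^sub>m n + s \<cdot>\<^sub>m A) * P) (1\<^sub>m n + s \<cdot>\<^sub>m A)"
    by (rule orthogonal_conjugate_similar[OF _ P PP(1)]) (use A in auto)
  hence "Determinant.det (1\<^sub>m n + s \<cdot>\<^sub>m A) = Determinant.det (mat_diag n (\<lambda>i. 1 + s * eig_desc A (Suc i)))"
    unfolding eq by (rule det_similar[symmetric])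
  also have "\<dots> = prod_list (diag_mat (mat_diag n (\<lambda>i. 1 + s * eig_desc A (Suc i))))"
    by (rule det_upper_triangular[of _ n]) (auto simp: mat_diag_def)
  also have "\<dots> = (\<Prod>i<n. 1 + s * eig_desc A (Suc i))"
    by (simp add: prod_list_diag_prod mat_diag_def atLeast0LessThan)
  finally show ?thesis .
qed

section \<open>Min-max bounds for ordered eigenvalues\<close>

lemma exists_nonzero_orthogonal_vec:
  fixes vs :: "'a :: field vec list"
  assumes len: "length vs < n" and vs: "set vs \<subseteq> carrier_vec n"
  obtains x where "x \<in> carrier_vec n" "x \<noteq> 0\<^sub>v n" "\<And>v. v \<in> set vs \<Longrightarrow> v \<bullet> x = 0"
proof -
  \<comment> \<open>Zero rows pad the homogeneous system to a square matrix, so that a vanishing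
    determinant yields a nonzero kernel vector.\<close>
  define B where "B = mat_of_rows n (vs @ replicate (n - length vs) (0\<^sub>v n))"
  have B: "B \<in> carrier_mat n n"
    using len mat_of_rows_carrier(1)[of n "vs @ replicate (n - length vs) (0\<^sub>v n)"] by (simp add: B_def)
  have rowB: "row B i = (vs @ replicate (n - length vs) (0\<^sub>v n)) ! i" if "i < n" for i
    unfolding B_def using that vs len by (intro mat_of_rows_row) (auto simp: nth_append subset_iff)
  have "row B (n - 1) = 0\<^sub>v n" using rowB[of "n - 1"] len by (subst rowB) (auto simp: nth_append)
  hence "B $$ (n - 1, i) = 0" if "i < n" for i
    using index_row(1)[of "n - 1" B i] B that len by simp
  hence "transpose_mat B *\<^sub>v unit_vec n (n - 1) = 0\<^sub>v n"
    using B len by (intro eq_vecI) auto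
  moreover have "unit_vec n (n - 1) \<noteq> (0\<^sub>v n :: 'a vec)"
    using len by (simp add: unit_vec_nonzero)
  ultimately have "Determinant.det (transpose_mat B) = 0"
    using det_0_iff_vec_prod_zero_field[of "transpose_mat B" n] B
    by (metis transpose_carrier_mat unit_vec_carrier)
  hence "Determinant.det B = 0" using det_transpose[OF B] by simp
  then obtain x where x: "x \<in> carrier_vec n" "x \<noteq> 0\<^sub>v n" "B *\<^sub>v x = 0\<^sub>v n"
    using det_0_iff_vec_prod_zero_field[OF B] by auto
  show thesis
  proof (rule that[OF x(1,2)])
    fix v assume "v \<in> set vs"
    then obtain i where i: "i < length vs" "v = vs ! i" by (auto simp: set_conv_nth)
    have "v \<bullet> x = (B *\<^sub>v x) $ i" using i len B rowB[of i] by (simp add: nth_append)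
    thus "v \<bullet> x = 0" using x i len by simp
  qed
qed

text \<open>One direction of the Courant-Fischer principle: some nonzero \<open>x\<close> in the
  span of the first \<open>m + 1\<close> eigenvectors is orthogonal to \<open>V\<close>. There the
  form is at least \<open>eig_desc A (Suc m)\<close> times \<open>x \<bullet> x\<close>, and by
  hypothesis at most \<open>c\<close> times it.\<close>

lemma eig_desc_le:
  fixes A :: "real mat"
  assumes A: "A \<in> carrier_mat n n" and sym: "transpose_mat A = A"
    and V: "finite V" "V \<subseteq> carrier_vec n" "card V \<le> m" and m: "m < n"
    and le: "\<And>x. x \<in> carrier_vec n \<Longrightarrow> (\<And>v. v \<in> V \<Longrightarrow> v \<bullet> x = 0) \<Longrightarrow> x \<bullet> (A *\<^sub>v x) \<le> c * (x \<bullet> x)"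
  shows "eig_desc A (Suc m) \<le> c"
proof -
  obtain u where u: "\<And>i. i < n \<Longrightarrow> u i \<in> carrier_vec n"
    and orth: "\<And>i j. i < n \<Longrightarrow> j < n \<Longrightarrow> u i \<bullet> u j = (if i = j then 1 else 0)"
    and xx: "\<And>x. x \<in> carrier_vec n \<Longrightarrow> x \<bullet> x = (\<Sum>i<n. (u i \<bullet> x)\<^sup>2)"
    and xAx: "\<And>x. x \<in> carrier_vec n \<Longrightarrow> x \<bullet> (A *\<^sub>v x) = (\<Sum>i<n. eig_desc A (Suc i) * (u i \<bullet> x)\<^sup>2)"
    by (rule eig_desc_eigenbasis[OF A sym]) (rule that)
  obtain vs where vs: "set vs = V" "length vs = card V"
    using V(1) by (metis distinct_card finite_distinct_list)
  \<comment> \<open>At most \<open>m\<close> constraints from \<open>V\<close> and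
    \<open>n - m - 1\<close> eigenvectors of higher index: fewer than \<open>n\<close> conditions in
    all.\<close>
  have "length (vs @ map u [Suc m..<n]) < n" using vs V(3) m by simp
  moreover have "set (vs @ map u [Suc m..<n]) \<subseteq> carrier_vec n" using vs V(2) u by auto
  ultimately obtain x where x: "x \<in> carrier_vec n" "x \<noteq> 0\<^sub>v n"
    "\<And>v. v \<in> set (vs @ map u [Suc m..<n]) \<Longrightarrow> v \<bullet> x = 0"
    using exists_nonzero_orthogonal_vec by blast
  have ux: "u i \<bullet> x = 0" if "m < i" "i < n" for i using that by (intro x(3)) auto
  have "eig_desc A (Suc m) * (x \<bullet> x) = (\<Sum>i<n. eig_desc A (Suc m) * (u i \<bullet> x)\<^sup>2)"
    by (simp add: xx[OF x(1)] sum_distrib_left)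
  also have "\<dots> \<le> (\<Sum>i<n. eig_desc A (Suc i) * (u i \<bullet> x)\<^sup>2)"
  proof (rule sum_mono)
    fix i assume i: "i \<in> {..<n}"
    show "eig_desc A (Suc m) * (u i \<bullet> x)\<^sup>2 \<le> eig_desc A (Suc i) * (u i \<bullet> x)\<^sup>2"
    proof (cases "i \<le> m")
      case True
      thus ?thesis using eig_desc_antimono[OF A sym True m] by (intro mult_right_mono) auto
    next
      case False
      thus ?thesis using ux i by simp
    qed
  qed
  also have "\<dots> = x \<bullet> (A *\<^sub>v x)" by (simp add: xAx[OF x(1)])
  also have "\<dots> \<le> c * (x \<bullet> x)" using x(1,3) vs by (intro le) auto
  finally show ?thesis using scalar_prod_self_pos[OF x(1,2)] by simp
qed

lemma eig_desc_nonneg: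
  fixes A :: "real mat"
  assumes A: "A \<in> carrier_mat n n" and sym: "transpose_mat A = A"
    and psd: "\<And>x. x \<in> carrier_vec n \<Longrightarrow> 0 \<le> x \<bullet> (A *\<^sub>v x)" and i: "i < n"
  shows "0 \<le> eig_desc A (Suc i)"
proof -
  obtain u where u: "\<And>i. i < n \<Longrightarrow> u i \<in> carrier_vec n"
    and orth: "\<And>i j. i < n \<Longrightarrow> j < n \<Longrightarrow> u i \<bullet> u j = (if i = j then 1 else 0)"
    and xx: "\<And>x. x \<in> carrier_vec n \<Longrightarrow> x \<bullet> x = (\<Sum>i<n. (u i \<bullet> x)\<^sup>2)"
    and xAx: "\<And>x. x \<in> carrier_vec n \<Longrightarrow> x \<bullet> (A *\<^sub>v x) = (\<Sum>i<n. eig_desc A (Suc i) * (u i \<bullet> x)\<^sup>2)"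
    by (rule eig_desc_eigenbasis[OF A sym]) (rule that)
  \<comment> \<open>Testing the form on a basis eigenvector isolates its eigenvalue.\<close>
  have "u i \<bullet> (A *\<^sub>v u i) = (\<Sum>j<n. if i = j then eig_desc A (Suc j) else 0)"
    unfolding xAx[OF u[OF i]] using orth i by (intro sum.cong) auto
  thus ?thesis using psd[OF u[OF i]] i by simp
qed

text \<open>Weyl's inequality for a perturbation that vanishes on the orthogonal complement of \<open>k\<close> vectors.\<close>

lemma eig_desc_low_rank_perturbation:
  fixes A B :: "real mat"
  assumes A: "A \<in> carrier_mat n n" "transpose_mat A = A"
    and B: "B \<in> carrier_mat n n" "transpose_mat B = B"
    and V: "finite V" "V \<subseteq> carrier_vec n" "card V \<le> k"
    and le: "\<And>x. x \<in> carrier_vec n \<Longrightarrow> (\<And>v. v \<in> V \<Longrightarrow> v \<bullet> x = 0) \<Longrightarrow> x \<bullet> (B *\<^sub>v x) \<le> x \<bullet> (A *\<^sub>v x)"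
    and i: "i + k < n"
  shows "eig_desc B (Suc (i + k)) \<le> eig_desc A (Suc i)"
proof -
  obtain u where u: "\<And>i. i < n \<Longrightarrow> u i \<in> carrier_vec n"
    and orth: "\<And>i j. i < n \<Longrightarrow> j < n \<Longrightarrow> u i \<bullet> u j = (if i = j then 1 else 0)"
    and xx: "\<And>x. x \<in> carrier_vec n \<Longrightarrow> x \<bullet> x = (\<Sum>i<n. (u i \<bullet> x)\<^sup>2)"
    and xAx: "\<And>x. x \<in> carrier_vec n \<Longrightarrow> x \<bullet> (A *\<^sub>v x) = (\<Sum>i<n. eig_desc A (Suc i) * (u i \<bullet> x)\<^sup>2)"
    by (rule eig_desc_eigenbasis[OF A]) (rule that)
  show ?thesis
  \<comment> \<open>Orthogonality to the first \<open>i\<close> eigenvectors of \<open>A\<close>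
    bounds the form of \<open>A\<close> by \<open>eig_desc A (Suc i)\<close>; together with
    \<open>V\<close> this costs at most \<open>i + k\<close> constraints on the form of
    \<open>B\<close>.\<close>
  proof (rule eig_desc_le[OF B, of "V \<union> u ` {..<i}"])
    show "card (V \<union> u ` {..<i}) \<le> i + k"
      using card_Un_le[of V "u ` {..<i}"] card_image_le[of "{..<i}" u] V(3) by simp
    fix x :: "real vec"
    assume x: "x \<in> carrier_vec n" and orth: "\<And>v. v \<in> V \<union> u ` {..<i} \<Longrightarrow> v \<bullet> x = 0"
    have "x \<bullet> (B *\<^sub>v x) \<le> x \<bullet> (A *\<^sub>v x)" using x orth by (intro le) auto
    also have "\<dots> \<le> (\<Sum>j<n. eig_desc A (Suc i) * (u j \<bullet> x)\<^sup>2)"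
      unfolding xAx[OF x]
    proof (rule sum_mono)
      fix j assume j: "j \<in> {..<n}"
      show "eig_desc A (Suc j) * (u j \<bullet> x)\<^sup>2 \<le> eig_desc A (Suc i) * (u j \<bullet> x)\<^sup>2"
      proof (cases "i \<le> j")
        case True
        thus ?thesis using eig_desc_antimono[OF A True] j by (intro mult_right_mono) auto
      next
        case False
        thus ?thesis using orth[of "u j"] by simp
      qed
    qed
    also have "\<dots> = eig_desc A (Suc i) * (x \<bullet> x)" by (simp add: xx[OF x] sum_distrib_left)
    finally show "x \<bullet> (B *\<^sub>v x) \<le> eig_desc A (Suc i) * (x \<bullet> x)" .
  qed (use V u i in auto)
qed

section \<open>Rank-one updates and the operator norm\<close>

text \<open>Sylvester's determinant identity. The block matrix with rows \<open>1, - B\<close> and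
  \<open>A, 1\<close> factors both as upper times lower and as lower times upper block triangular,
  and the two factorizations give the two sides.\<close>

lemma det_one_plus_mult_commute:
  fixes A B :: "'a :: idom mat"
  assumes A: "A \<in> carrier_mat m n" and B: "B \<in> carrier_mat n m"
  shows "Determinant.det (1\<^sub>m m + A * B) = Determinant.det (1\<^sub>m n + B * A)"
proof -
  have "four_block_mat (1\<^sub>m n + B * A) (- B) (0\<^sub>m m n) (1\<^sub>m m) * four_block_mat (1\<^sub>m n) (0\<^sub>m n m) A (1\<^sub>m m)
      = four_block_mat (1\<^sub>m n) (- B) A (1\<^sub>m m)"
    using A B by (subst mult_four_block_mat[of _ n n _ m _ m _ _ n _ m])
      (auto intro!: cong_four_block_mat eq_matI)
  also have "\<dots> = four_block_mat (1\<^sub>m n) (0\<^sub>m n m) A (1\<^sub>m m) * four_block_mat (1\<^sub>m n) (- B) (0\<^sub>m m n) (1\<^sub>m m + A * B)"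
    using A B by (subst mult_four_block_mat[of _ n n _ m _ m _ _ n _ m])
      (auto intro!: cong_four_block_mat eq_matI)
  finally have eq: "four_block_mat (1\<^sub>m n + B * A) (- B) (0\<^sub>m m n) (1\<^sub>m m) * four_block_mat (1\<^sub>m n) (0\<^sub>m n m) A (1\<^sub>m m)
      = four_block_mat (1\<^sub>m n) (0\<^sub>m n m) A (1\<^sub>m m) * four_block_mat (1\<^sub>m n) (- B) (0\<^sub>m m n) (1\<^sub>m m + A * B)" .
  have L: "Determinant.det (four_block_mat (1\<^sub>m n) (0\<^sub>m n m) A (1\<^sub>m m)) = 1"
    using A by (subst det_four_block_mat_upper_right_zero[of _ n _ m]) auto
  have U: "Determinant.det (four_block_mat (1\<^sub>m n + B * A) (- B) (0\<^sub>m m n) (1\<^sub>m m)) = Determinant.det (1\<^sub>m n + B * A)"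
    using A B by (subst det_four_block_mat_lower_left_zero[of _ n _ m]) auto
  have V: "Determinant.det (four_block_mat (1\<^sub>m n) (- B) (0\<^sub>m m n) (1\<^sub>m m + A * B)) = Determinant.det (1\<^sub>m m + A * B)"
    using A B by (subst det_four_block_mat_lower_left_zero[of _ n _ m]) auto
  have carr: "four_block_mat (1\<^sub>m n + B * A) (- B) (0\<^sub>m m n) (1\<^sub>m m) \<in> carrier_mat (n + m) (n + m)"
    "four_block_mat (1\<^sub>m n) (0\<^sub>m n m) A (1\<^sub>m m) \<in> carrier_mat (n + m) (n + m)"
    "four_block_mat (1\<^sub>m n) (- B) (0\<^sub>m m n) (1\<^sub>m m + A * B) \<in> carrier_mat (n + m) (n + m)"
    using A B by auto
  from arg_cong[OF eq, of Determinant.det] show ?thesis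
    by (simp add: det_mult[OF carr(1,2)] det_mult[OF carr(2,3)] L U V)
qed

definition outer_prod :: "'a :: semiring_0 vec \<Rightarrow> 'a vec \<Rightarrow> 'a mat" where
  "outer_prod u v = mat (dim_vec u) (dim_vec v) (\<lambda>(i, j). u $ i * v $ j)"

lemma outer_prod_carrier [simp]:
  "u \<in> carrier_vec n \<Longrightarrow> v \<in> carrier_vec m \<Longrightarrow> outer_prod u v \<in> carrier_mat n m"
  by (auto simp: outer_prod_def)

text \<open>The rank-one case of the preceding identity: a column times a row on one side, a 1 by 1
  matrix on the other.\<close>

lemma det_one_plus_outer_prod:
  fixes u v :: "'a :: idom vec"
  assumes u: "u \<in> carrier_vec n" and v: "v \<in> carrier_vec n"
  shows "Determinant.det (1\<^sub>m n + outer_prod u v) = 1 + v \<bullet> u"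
proof -
  define U where "U = mat n 1 (\<lambda>(i, j). u $ i)"
  define V where "V = mat 1 n (\<lambda>(i, j). v $ j)"
  have "outer_prod u v = U * V"
    using u v by (intro eq_matI) (auto simp: outer_prod_def U_def V_def scalar_prod_def)
  hence "Determinant.det (1\<^sub>m n + outer_prod u v) = Determinant.det (1\<^sub>m 1 + V * U)"
    by (simp only:, intro det_one_plus_mult_commute) (auto simp: U_def V_def)
  also have "1\<^sub>m 1 + V * U = mat 1 1 (\<lambda>_. 1 + v \<bullet> u)"
    using u v by (intro eq_matI) (auto simp: U_def V_def scalar_prod_def)
  finally show ?thesis by (simp add: det_def sign_def)
qed

text \<open>The form is nonnegative at \<open>c\<close> times the part of \<open>x\<close> that is
  form-orthogonal to \<open>y\<close>; expanding there gives \<open>c * (c * a - b * b)\<close>, and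
  \<open>c > 0\<close> is cancelled.\<close>

lemma positive_semidefinite_cauchy_schwarz:
  fixes A :: "real mat"
  assumes A: "A \<in> carrier_mat n n" and sym: "transpose_mat A = A"
    and psd: "\<And>x. x \<in> carrier_vec n \<Longrightarrow> 0 \<le> x \<bullet> (A *\<^sub>v x)"
    and x: "x \<in> carrier_vec n" and y: "y \<in> carrier_vec n" and pos: "0 < y \<bullet> (A *\<^sub>v y)"
  shows "(x \<bullet> (A *\<^sub>v y))\<^sup>2 \<le> (x \<bullet> (A *\<^sub>v x)) * (y \<bullet> (A *\<^sub>v y))"
proof -
  define a b c where "a = x \<bullet> (A *\<^sub>v x)" and "b = x \<bullet> (A *\<^sub>v y)" and "c = y \<bullet> (A *\<^sub>v y)"
  have Ax: "A *\<^sub>v x \<in> carrier_vec n" "A *\<^sub>v y \<in> carrier_vec n" using A x y by auto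
  have yx: "y \<bullet> (A *\<^sub>v x) = b"
    using symmetric_scalar_prod[OF A sym x y] comm_scalar_prod[OF Ax(1) y] by (simp add: b_def)
  define z where "z = c \<cdot>\<^sub>v x + (- b) \<cdot>\<^sub>v y"
  have z: "z \<in> carrier_vec n" using x y by (simp add: z_def)
  have Az: "A *\<^sub>v z = c \<cdot>\<^sub>v (A *\<^sub>v x) + (- b) \<cdot>\<^sub>v (A *\<^sub>v y)"
    unfolding z_def using A x y
    by (subst mult_add_distrib_mat_vec[of _ n n]) (auto simp: mult_mat_vec[of _ n n])
  have "z \<bullet> (A *\<^sub>v z) = c * (c * a - b * b) - b * (c * b - b * c)"
    unfolding Az using x y Ax
    unfolding z_def
    by (simp add: add_scalar_prod_distrib[of _ n] scalar_prod_add_distrib[of _ n] yx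
        a_def[symmetric] b_def[symmetric] c_def[symmetric] algebra_simps)
  hence "0 \<le> c * (c * a - b * b)" using psd[OF z] by simp
  thus ?thesis using pos
    by (simp add: a_def[symmetric] b_def[symmetric] c_def[symmetric] zero_le_mult_iff power2_eq_square mult.commute)
qed

lemma scalar_prod_cauchy_schwarz:
  fixes x y :: "real vec"
  assumes x: "x \<in> carrier_vec n" and y: "y \<in> carrier_vec n"
  shows "(x \<bullet> y)\<^sup>2 \<le> (x \<bullet> x) * (y \<bullet> y)"
proof (cases "y = 0\<^sub>v n")
  case True
  thus ?thesis using x by simp
next
  case False
  thus ?thesis
    using positive_semidefinite_cauchy_schwarz[of "1\<^sub>m n" n x y] x y
      scalar_prod_self_ge_0 scalar_prod_self_pos[OF y] by simp
qed

text \<open>With \<open>y\<close> the solution of \<open>A y = g\<close>, the determinant grows by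
  the exact factor \<open>1 + c * (g \<bullet> y)\<close>. Cauchy-Schwarz for the form of
  \<open>A\<close> gives \<open>1 = (g \<bullet> x)^2\<close> at most
  \<open>(x \<bullet> A x) * (g \<bullet> y)\<close>, so every \<open>w\<close> with
  \<open>w * (x \<bullet> A x)\<close> at most 1 is a lower bound for
  \<open>g \<bullet> y\<close>.\<close>

lemma det_rank_one_update_ge:
  fixes A :: "real mat"
  assumes A: "A \<in> carrier_mat n n" and sym: "transpose_mat A = A"
    and pd: "\<And>x. x \<in> carrier_vec n \<Longrightarrow> x \<noteq> 0\<^sub>v n \<Longrightarrow> 0 < x \<bullet> (A *\<^sub>v x)"
    and det: "0 < Determinant.det A"
    and g: "g \<in> carrier_vec n" and x: "x \<in> carrier_vec n" and c: "0 \<le> c"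
    and gx: "g \<bullet> x = 1" and w: "w * (x \<bullet> (A *\<^sub>v x)) \<le> 1" "0 \<le> w"
  shows "Determinant.det A * (1 + c * w) \<le> Determinant.det (A + c \<cdot>\<^sub>m outer_prod g g)"
proof -
  obtain B where B: "A * B = 1\<^sub>m n" "B \<in> carrier_mat n n"
    using det_non_zero_imp_unit[OF A, of "()"] det
    by (auto simp: Units_def ring_mat_def)
  define y where "y = B *\<^sub>v g"
  have y: "y \<in> carrier_vec n" using B g by (simp add: y_def)
  have Ay: "A *\<^sub>v y = g"
    unfolding y_def using A B g by (simp add: assoc_mult_mat_vec[of _ n n _ n, symmetric] del: assoc_mult_mat_vec)
  have g0: "g \<noteq> 0\<^sub>v n" using gx x by auto
  have y0: "y \<noteq> 0\<^sub>v n" using Ay g0 A by auto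
  have Aouter: "A * outer_prod (c \<cdot>\<^sub>v y) g = c \<cdot>\<^sub>m outer_prod g g"
  proof (rule eq_matI)
    fix i j assume "i < dim_row (c \<cdot>\<^sub>m outer_prod g g)" "j < dim_col (c \<cdot>\<^sub>m outer_prod g g)"
    hence ij: "i < n" "j < n" using g by (auto simp: outer_prod_def)
    have "col (outer_prod (c \<cdot>\<^sub>v y) g) j = (c * g $ j) \<cdot>\<^sub>v y"
      using y g ij by (intro eq_vecI) (auto simp: outer_prod_def)
    moreover have "(A * outer_prod (c \<cdot>\<^sub>v y) g) $$ (i, j) = row A i \<bullet> col (outer_prod (c \<cdot>\<^sub>v y) g) j"
      using A g ij by (intro index_mult_mat(1)) (auto simp: outer_prod_def)
    moreover have "row A i \<in> carrier_vec n" using A ij by auto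
    ultimately have "(A * outer_prod (c \<cdot>\<^sub>v y) g) $$ (i, j) = c * g $ j * (row A i \<bullet> y)"
      using y by simp
    also have "row A i \<bullet> y = g $ i" using Ay A ij by (metis carrier_matD(1) index_mult_mat_vec)
    finally show "(A * outer_prod (c \<cdot>\<^sub>v y) g) $$ (i, j) = (c \<cdot>\<^sub>m outer_prod g g) $$ (i, j)"
      using g ij by (simp add: outer_prod_def)
  qed (use A g in \<open>auto simp: outer_prod_def\<close>)
  have cy: "outer_prod (c \<cdot>\<^sub>v y) g \<in> carrier_mat n n" using y g by simp
  \<comment> \<open>Pulling out \<open>A\<close> on the left reduces the update to a rank-one
    perturbation of the identity.\<close>
  have "A + c \<cdot>\<^sub>m outer_prod g g = A * (1\<^sub>m n + outer_prod (c \<cdot>\<^sub>v y) g)"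
    using A cy by (simp add: mult_add_distrib_mat[of _ n n _ n] Aouter)
  hence "Determinant.det (A + c \<cdot>\<^sub>m outer_prod g g) = Determinant.det A * (1 + g \<bullet> (c \<cdot>\<^sub>v y))"
    using A cy y g det_one_plus_outer_prod[of "c \<cdot>\<^sub>v y" n g] by (simp add: det_mult[of _ n])
  also have "g \<bullet> (c \<cdot>\<^sub>v y) = c * (g \<bullet> y)" using g y by simp
  finally have eq: "Determinant.det (A + c \<cdot>\<^sub>m outer_prod g g) = Determinant.det A * (1 + c * (g \<bullet> y))" .
  have gy: "g \<bullet> y = y \<bullet> (A *\<^sub>v y)" using Ay comm_scalar_prod[OF g y] by simp
  have pos: "0 < y \<bullet> (A *\<^sub>v y)" by (rule pd[OF y y0])
  have psd: "0 \<le> v \<bullet> (A *\<^sub>v v)" if "v \<in> carrier_vec n" for v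
    using pd[OF that] A that by (cases "v = 0\<^sub>v n") (auto intro: less_imp_le)
  have "1 = (x \<bullet> (A *\<^sub>v y))\<^sup>2" using gx comm_scalar_prod[OF g x] by (simp add: Ay)
  also have "\<dots> \<le> (x \<bullet> (A *\<^sub>v x)) * (g \<bullet> y)"
    unfolding gy by (rule positive_semidefinite_cauchy_schwarz[OF A sym psd x y pos])
  finally have "w * 1 \<le> w * ((x \<bullet> (A *\<^sub>v x)) * (g \<bullet> y))"
    using w(2) by (intro mult_left_mono) auto
  also have "\<dots> = (w * (x \<bullet> (A *\<^sub>v x))) * (g \<bullet> y)" by simp
  also have "\<dots> \<le> 1 * (g \<bullet> y)" using w(1) pos gy by (intro mult_right_mono) auto
  finally have "c * w \<le> c * (g \<bullet> y)" using c by (intro mult_left_mono) auto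
  thus ?thesis unfolding eq using det by simp
qed

section \<open>Euclidean norm and operator norm\<close>

lemma l2_norm_nonneg: "0 \<le> l2_norm v"
  by (simp add: l2_norm_def scalar_prod_self_ge_0)

lemma l2_norm_power2: "(l2_norm v)\<^sup>2 = v \<bullet> v"
  by (simp add: l2_norm_def scalar_prod_self_ge_0)

lemma l2_norm_smult: "l2_norm (a \<cdot>\<^sub>v v) = \<bar>a\<bar> * l2_norm v"
proof -
  have "(a \<cdot>\<^sub>v v) \<bullet> (a \<cdot>\<^sub>v v) = a\<^sup>2 * (v \<bullet> v)"
    by (simp add: power2_eq_square)
  thus ?thesis by (simp add: l2_norm_def real_sqrt_mult)
qed

lemma scalar_prod_le_l2_norm:
  assumes "x \<in> carrier_vec n" "y \<in> carrier_vec n"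
  shows "x \<bullet> y \<le> l2_norm x * l2_norm y"
proof -
  have "(x \<bullet> y)\<^sup>2 \<le> (l2_norm x * l2_norm y)\<^sup>2"
    using scalar_prod_cauchy_schwarz[OF assms] by (simp add: power_mult_distrib l2_norm_power2)
  thus ?thesis by (rule power2_le_imp_le) (simp add: l2_norm_nonneg)
qed

text \<open>Cauchy-Schwarz in each row bounds the values by the Frobenius norm. Without boundedness
  the supremum in \<open>op_norm\<close> would carry no information.\<close>

lemma op_norm_bdd_above:
  fixes A :: "real mat"
  shows "bdd_above ((\<lambda>v. l2_norm (A *\<^sub>v v)) ` {v \<in> carrier_vec (dim_col A). l2_norm v \<le> 1})"
proof (rule bdd_aboveI2)
  fix v assume v: "v \<in> {v \<in> carrier_vec (dim_col A). l2_norm v \<le> 1}"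
  hence v1: "v \<bullet> v \<le> 1"
    by (metis (mono_tags, lifting) l2_norm_nonneg l2_norm_power2 mem_Collect_eq power_le_one)
  have "(A *\<^sub>v v) \<bullet> (A *\<^sub>v v) = (\<Sum>i<dim_row A. (row A i \<bullet> v)\<^sup>2)"
    by (simp add: scalar_prod_def[of "A *\<^sub>v v"] power2_eq_square atLeast0LessThan)
  also have "\<dots> \<le> (\<Sum>i<dim_row A. row A i \<bullet> row A i)"
  proof (rule sum_mono)
    fix i
    have "(row A i \<bullet> v)\<^sup>2 \<le> (row A i \<bullet> row A i) * (v \<bullet> v)"
      using v by (intro scalar_prod_cauchy_schwarz[of _ "dim_col A"]) auto
    also have "\<dots> \<le> (row A i \<bullet> row A i) * 1"
      using v1 by (intro mult_left_mono scalar_prod_self_ge_0)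
    finally show "(row A i \<bullet> v)\<^sup>2 \<le> row A i \<bullet> row A i" by simp
  qed
  finally show "l2_norm (A *\<^sub>v v) \<le> sqrt (\<Sum>i<dim_row A. row A i \<bullet> row A i)"
    by (simp add: l2_norm_def)
qed

lemma op_norm_nonneg: "0 \<le> op_norm A"
proof -
  have "l2_norm (A *\<^sub>v 0\<^sub>v (dim_col A)) \<le> op_norm A"
    unfolding op_norm_def by (rule cSUP_upper[OF _ op_norm_bdd_above]) (simp add: l2_norm_def)
  thus ?thesis using l2_norm_nonneg[of "A *\<^sub>v 0\<^sub>v (dim_col A)"] by linarith
qed

lemma l2_norm_mult_mat_vec_le:
  assumes A: "A \<in> carrier_mat m n" and x: "x \<in> carrier_vec n"
  shows "l2_norm (A *\<^sub>v x) \<le> op_norm A * l2_norm x"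
proof (cases "l2_norm x = 0")
  case True
  hence "x = 0\<^sub>v n" using scalar_prod_self_eq_0_iff[OF x] l2_norm_power2[of x] by simp
  moreover have "A *\<^sub>v 0\<^sub>v n = 0\<^sub>v m" using A by (intro eq_vecI) auto
  ultimately show ?thesis by (simp add: l2_norm_def)
next
  case False
  hence pos: "0 < l2_norm x" using l2_norm_nonneg[of x] by simp
  have "l2_norm (A *\<^sub>v ((1 / l2_norm x) \<cdot>\<^sub>v x)) \<le> op_norm A"
    unfolding op_norm_def
    by (rule cSUP_upper[OF _ op_norm_bdd_above]) (use A x pos in \<open>simp add: l2_norm_smult\<close>)
  also have "A *\<^sub>v ((1 / l2_norm x) \<cdot>\<^sub>v x) = (1 / l2_norm x) \<cdot>\<^sub>v (A *\<^sub>v x)"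
    by (rule mult_mat_vec[OF A x])
  finally show ?thesis using pos by (simp add: l2_norm_smult field_simps)
qed

lemma quadratic_form_le_op_norm:
  assumes A: "A \<in> carrier_mat n n" and x: "x \<in> carrier_vec n"
  shows "x \<bullet> (A *\<^sub>v x) \<le> op_norm A * (x \<bullet> x)"
proof -
  have "x \<bullet> (A *\<^sub>v x) \<le> l2_norm x * l2_norm (A *\<^sub>v x)"
    using A x by (intro scalar_prod_le_l2_norm) auto
  also have "\<dots> \<le> l2_norm x * (op_norm A * l2_norm x)"
    by (intro mult_left_mono l2_norm_mult_mat_vec_le[OF A x] l2_norm_nonneg)
  also have "\<dots> = op_norm A * (x \<bullet> x)"
    by (simp add: l2_norm_power2[symmetric] power2_eq_square)
  finally show ?thesis .
qed

text \<open>The transpose has no larger norm: for \<open>y\<close> the image of \<open>x\<close>,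
  \<open>y \<bullet> y = x \<bullet> A y\<close> is at most the product of the norms of
  \<open>x\<close>, \<open>A\<close> and \<open>y\<close>, and one norm of \<open>y\<close> cancels.
  Applied to \<open>G\<close>, it bounds the sum of the squares of the products of \<open>x\<close>
  with the columns.\<close>

lemma transpose_mult_vec_le_op_norm:
  assumes A: "A \<in> carrier_mat m n" and x: "x \<in> carrier_vec m"
  shows "(transpose_mat A *\<^sub>v x) \<bullet> (transpose_mat A *\<^sub>v x) \<le> (op_norm A)\<^sup>2 * (x \<bullet> x)"
proof -
  define y where "y = transpose_mat A *\<^sub>v x"
  have y: "y \<in> carrier_vec n" using A x by (simp add: y_def)
  have "l2_norm y * l2_norm y = y \<bullet> y" by (simp add: l2_norm_power2[symmetric] power2_eq_square)
  also have "\<dots> = x \<bullet> (A *\<^sub>v y)" using transpose_vec_mult_scalar[OF A y x] by (simp add: y_def)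
  also have "\<dots> \<le> l2_norm x * l2_norm (A *\<^sub>v y)"
    using A x y by (intro scalar_prod_le_l2_norm) auto
  also have "\<dots> \<le> l2_norm x * (op_norm A * l2_norm y)"
    by (intro mult_left_mono l2_norm_mult_mat_vec_le[OF A y] l2_norm_nonneg)
  finally have "l2_norm y * l2_norm y \<le> (op_norm A * l2_norm x) * l2_norm y" by (simp add: mult_ac)
  hence "l2_norm y \<le> op_norm A * l2_norm x"
    using l2_norm_nonneg[of y] l2_norm_nonneg[of x] op_norm_nonneg[of A]
    by (cases "l2_norm y = 0") auto
  hence "(l2_norm y)\<^sup>2 \<le> (op_norm A * l2_norm x)\<^sup>2"
    by (intro power_mono l2_norm_nonneg)
  thus ?thesis by (simp add: power_mult_distrib l2_norm_power2 y_def)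
qed

section \<open>Weighted Gram matrices\<close>

lemma weighted_gram_carrier [simp]:
  "G \<in> carrier_mat q N \<Longrightarrow> weighted_gram G r J \<in> carrier_mat q q"
  by (auto simp: weighted_gram_def)

lemma transpose_weighted_gram [simp]: "transpose_mat (weighted_gram G r J) = weighted_gram G r J"
  by (rule eq_matI) (auto simp: weighted_gram_def mult_ac)

text \<open>Reduces every comparison between the matrices built from \<open>G\<close> to a
  comparison of sums of nonnegative terms over index sets.\<close>

lemma weighted_gram_quadratic_form:
  assumes G: "G \<in> carrier_mat q N" and x: "x \<in> carrier_vec q"
  shows "x \<bullet> (weighted_gram G r J *\<^sub>v x) = (\<Sum>j\<in>J. r j * (col G j \<bullet> x)\<^sup>2)"
proof -
  have "x \<bullet> (weighted_gram G r J *\<^sub>v x) =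
      (\<Sum>a<q. \<Sum>b<q. \<Sum>j\<in>J. r j * ((col G j $ a * x $ a) * (col G j $ b * x $ b)))"
    using G x
    by (simp add: scalar_prod_def weighted_gram_def atLeast0LessThan sum_distrib_left sum_distrib_right mult_ac)
  also have "\<dots> = (\<Sum>a<q. \<Sum>j\<in>J. \<Sum>b<q. r j * ((col G j $ a * x $ a) * (col G j $ b * x $ b)))"
    by (intro sum.cong refl sum.swap)
  also have "\<dots> = (\<Sum>j\<in>J. \<Sum>a<q. \<Sum>b<q. r j * ((col G j $ a * x $ a) * (col G j $ b * x $ b)))"
    by (rule sum.swap)
  also have "\<dots> = (\<Sum>j\<in>J. r j * (col G j \<bullet> x)\<^sup>2)"
  proof (intro sum.cong refl)
    fix j
    have "col G j \<bullet> x = (\<Sum>a<q. col G j $ a * x $ a)"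
      using x by (simp add: scalar_prod_def atLeast0LessThan)
    hence "(col G j \<bullet> x)\<^sup>2 = (\<Sum>a<q. \<Sum>b<q. (col G j $ a * x $ a) * (col G j $ b * x $ b))"
      by (simp only: power2_eq_square sum_product)
    thus "(\<Sum>a<q. \<Sum>b<q. r j * ((col G j $ a * x $ a) * (col G j $ b * x $ b))) = r j * (col G j \<bullet> x)\<^sup>2"
      by (simp only: sum_distrib_left)
  qed
  finally show ?thesis .
qed

lemma weighted_gram_insert:
  assumes "G \<in> carrier_mat q N" "finite J" "j \<notin> J"
  shows "weighted_gram G r (insert j J) = weighted_gram G r J + r j \<cdot>\<^sub>m outer_prod (col G j) (col G j)"
  using assms by (intro eq_matI) (auto simp: weighted_gram_def outer_prod_def)

lemma weighted_gram_psd: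
  assumes "G \<in> carrier_mat q N" "x \<in> carrier_vec q" "\<And>j. j \<in> J \<Longrightarrow> 0 \<le> r j"
  shows "0 \<le> x \<bullet> (weighted_gram G r J *\<^sub>v x)"
  using assms by (auto simp: weighted_gram_quadratic_form intro!: sum_nonneg)

lemma transpose_one_plus_smult:
  "A \<in> carrier_mat n n \<Longrightarrow> transpose_mat A = A \<Longrightarrow> transpose_mat (1\<^sub>m n + c \<cdot>\<^sub>m A) = 1\<^sub>m n + c \<cdot>\<^sub>m A"
  for A :: "'a :: semiring_1 mat"
proof -
  assume A: "A \<in> carrier_mat n n" and sym: "transpose_mat A = A"
  have "A $$ (j, i) = A $$ (i, j)" if "i < n" "j < n" for i j
    using arg_cong[OF sym, of "\<lambda>B. B $$ (i, j)"] A that by simp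
  thus ?thesis using A by (intro eq_matI) auto
qed

lemma one_plus_smult_quadratic_form:
  fixes A :: "'a :: comm_ring_1 mat"
  assumes A: "A \<in> carrier_mat n n" and x: "x \<in> carrier_vec n"
  shows "x \<bullet> ((1\<^sub>m n + c \<cdot>\<^sub>m A) *\<^sub>v x) = x \<bullet> x + c * (x \<bullet> (A *\<^sub>v x))"
proof -
  have "(1\<^sub>m n + c \<cdot>\<^sub>m A) *\<^sub>v x = x + c \<cdot>\<^sub>v (A *\<^sub>v x)"
    using A x by (intro eq_vecI) (auto simp: add_scalar_prod_distrib[of _ n])
  thus ?thesis using A x by (simp add: scalar_prod_add_distrib[of _ n])
qed

text \<open>All eigenvalues of the Gram matrix are nonnegative, so every factor of the determinant
  is at least 1.\<close>

lemma det_one_plus_weighted_gram_ge_1: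
  assumes G: "G \<in> carrier_mat q N" and c: "0 \<le> c" and r: "\<And>j. j \<in> J \<Longrightarrow> 0 \<le> r j"
  shows "1 \<le> Determinant.det (1\<^sub>m q + c \<cdot>\<^sub>m weighted_gram G r J)"
proof -
  have "1 \<le> (\<Prod>i<q. 1 + c * eig_desc (weighted_gram G r J) (Suc i))"
    using c eig_desc_nonneg[OF weighted_gram_carrier[OF G] transpose_weighted_gram weighted_gram_psd[OF G _ r]]
    by (intro prod_ge_1) auto
  thus ?thesis using det_one_plus_smult_eig_desc[OF weighted_gram_carrier[OF G] transpose_weighted_gram] by simp
qed

text \<open>The columns of \<open>L\<close> are added one at a time, each multiplying the
  determinant by at least \<open>1 + c * r j * w\<close>. The hypothesis on \<open>x\<close> refers
  to all columns other than \<open>j\<close>, so it serves at every stage and in every order of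
  insertion.\<close>

lemma det_one_plus_weighted_gram_Un_ge:
  assumes G: "G \<in> carrier_mat q N" and c: "0 \<le> c" and w: "0 \<le> w"
    and J: "finite J" and L: "finite L" "J \<inter> L = {}"
    and r: "\<And>j. j \<in> J \<union> L \<Longrightarrow> 0 \<le> r j"
    and dual: "\<And>j. j \<in> L \<Longrightarrow> \<exists>x\<in>carrier_vec q. col G j \<bullet> x = 1 \<and>
      w * (x \<bullet> x + c * (\<Sum>i\<in>J \<union> L - {j}. r i * (col G i \<bullet> x)\<^sup>2)) \<le> 1"
  shows "Determinant.det (1\<^sub>m q + c \<cdot>\<^sub>m weighted_gram G r J) * (\<Prod>j\<in>L. 1 + c * r j * w)
    \<le> Determinant.det (1\<^sub>m q + c \<cdot>\<^sub>m weighted_gram G r (J \<union> L))"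
  using L(1) subset_refl[of L]
proof (induction rule: finite_subset_induct')
  case (insert j L')
  let ?Q = "\<lambda>J. 1\<^sub>m q + c \<cdot>\<^sub>m weighted_gram G r J"
  have Q: "?Q (J \<union> L') \<in> carrier_mat q q" using G by simp
  have sym: "transpose_mat (?Q (J \<union> L')) = ?Q (J \<union> L')"
    by (rule transpose_one_plus_smult[OF weighted_gram_carrier[OF G] transpose_weighted_gram])
  have quad: "x \<bullet> (?Q (J \<union> L') *\<^sub>v x) = x \<bullet> x + c * (\<Sum>i\<in>J \<union> L'. r i * (col G i \<bullet> x)\<^sup>2)"
    if "x \<in> carrier_vec q" for x
    using one_plus_smult_quadratic_form[OF weighted_gram_carrier[OF G] that] weighted_gram_quadratic_form[OF G that]
    by simp
  have nonneg: "0 \<le> (\<Sum>i\<in>J \<union> L'. r i * (col G i \<bullet> x)\<^sup>2)" for x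
    using r insert.hyps by (intro sum_nonneg mult_nonneg_nonneg) auto
  obtain x where x: "x \<in> carrier_vec q" "col G j \<bullet> x = 1"
    "w * (x \<bullet> x + c * (\<Sum>i\<in>J \<union> L - {j}. r i * (col G i \<bullet> x)\<^sup>2)) \<le> 1"
    using dual insert.hyps by blast
  \<comment> \<open>The columns present before \<open>j\<close> is inserted are among those other
    than \<open>j\<close>, and dropping nonnegative terms only decreases the form.\<close>
  have "(\<Sum>i\<in>J \<union> L'. r i * (col G i \<bullet> x)\<^sup>2) \<le> (\<Sum>i\<in>J \<union> L - {j}. r i * (col G i \<bullet> x)\<^sup>2)"
    using insert.hyps L J r by (intro sum_mono2) auto
  hence "w * (x \<bullet> (?Q (J \<union> L') *\<^sub>v x)) \<le> w * (x \<bullet> x + c * (\<Sum>i\<in>J \<union> L - {j}. r i * (col G i \<bullet> x)\<^sup>2))"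
    unfolding quad[OF x(1)] using c w by (intro mult_left_mono add_left_mono) auto
  hence wx: "w * (x \<bullet> (?Q (J \<union> L') *\<^sub>v x)) \<le> 1" using x(3) by linarith
  have "Determinant.det (?Q J) * (\<Prod>i\<in>insert j L'. 1 + c * r i * w) =
      (Determinant.det (?Q J) * (\<Prod>i\<in>L'. 1 + c * r i * w)) * (1 + c * r j * w)"
    using insert.hyps by simp
  also have "\<dots> \<le> Determinant.det (?Q (J \<union> L')) * (1 + c * r j * w)"
    using insert.IH insert.hyps r c w by (intro mult_right_mono) auto
  also have "\<dots> \<le> Determinant.det (?Q (J \<union> L') + (c * r j) \<cdot>\<^sub>m outer_prod (col G j) (col G j))"
  proof (rule det_rank_one_update_ge[OF Q sym _ _ _ x(1) _ x(2) wx w])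
    show "0 < Determinant.det (?Q (J \<union> L'))"
      using det_one_plus_weighted_gram_ge_1[OF G c, of "J \<union> L'" r] r insert.hyps by fastforce
    show "0 < v \<bullet> (?Q (J \<union> L') *\<^sub>v v)" if "v \<in> carrier_vec q" "v \<noteq> 0\<^sub>v q" for v
      unfolding quad[OF that(1)] using scalar_prod_self_pos[OF that] nonneg[of v] c
      by (intro add_pos_nonneg) auto
  qed (use G r c insert.hyps in auto)
  also have "?Q (J \<union> L') + (c * r j) \<cdot>\<^sub>m outer_prod (col G j) (col G j) = ?Q (J \<union> insert j L')"
  proof -
    have "j \<notin> J \<union> L'" "finite (J \<union> L')" using insert.hyps J L finite_subset[of L' L] by auto
    hence "weighted_gram G r (J \<union> insert j L') =
        weighted_gram G r (J \<union> L') + r j \<cdot>\<^sub>m outer_prod (col G j) (col G j)"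
      using weighted_gram_insert[OF G, of "J \<union> L'" j r] by simp
    thus ?thesis
      using G by (intro eq_matI) (auto simp: outer_prod_def weighted_gram_def algebra_simps)
  qed
  finally show ?case .
qed simp

section \<open>Full column rank and dual vectors\<close>

lemma full_column_rank_inj:
  fixes A :: "'a :: field mat"
  assumes A: "A \<in> carrier_mat n p" and rank: "vec_space.rank n A = p"
    and z: "z \<in> carrier_vec p" and Az: "A *\<^sub>v z = 0\<^sub>v n"
  shows "z = 0\<^sub>v p"
proof -
  interpret vec_space "TYPE('a)" n .
  \<comment> \<open>Linear independence concerns the set of columns, so a repeated column must be
    excluded first: it would leave fewer than \<open>p\<close> vectors and force a smaller
    rank.\<close>
  have dist: "distinct (cols A)"
  proof (rule ccontr)
    assume "\<not> distinct (cols A)"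
    hence less: "card (set (cols A)) < p"
      using A by (metis card_distinct card_length carrier_matD(2) cols_length le_neq_implies_less)
    obtain S where S: "maximal S (\<lambda>T. T \<subseteq> set (cols A) \<and> lin_indpt T)"
      using maximal_exists[of "(\<lambda>T. T \<subseteq> set (cols A) \<and> lin_indpt T)" "card (set (cols A))" "{}"]
      by (meson List.finite_set card_mono empty_iff empty_subsetI finite_lin_indpt2 rev_finite_subset)
    have "card S \<le> card (set (cols A))" using S by (simp add: card_mono maximal_def)
    thus False using less rank rank_card_indpt[OF A S] by simp
  qed
  show ?thesis
    using lin_depI[OF A z _ Az dist] full_rank_lin_indpt[OF A rank dist] by blast
qed

text \<open>The dual vector is \<open>x = H y\<close>, where \<open>y\<close> solves
  \<open>A y = unit_vec p a\<close> for the Gram matrix \<open>A\<close> of the columns of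
  \<open>H\<close>. It lies in the column space of \<open>H\<close>, which is why its norm is
  controlled by \<open>s_min H\<close>.\<close>

lemma s_min_dual_basis:
  fixes H :: "real mat"
  assumes H: "H \<in> carrier_mat q p" and p: "0 < p"
    and inj: "\<And>z. z \<in> carrier_vec p \<Longrightarrow> H *\<^sub>v z = 0\<^sub>v q \<Longrightarrow> z = 0\<^sub>v p"
  shows "0 < s_min H"
    and "\<And>a. a < p \<Longrightarrow> \<exists>x\<in>carrier_vec q. (\<forall>b<p. col H b \<bullet> x = (if b = a then 1 else 0)) \<and>
      (s_min H)\<^sup>2 * (x \<bullet> x) \<le> 1"
proof -
  define A where "A = transpose_mat H * H"
  define \<mu> where "\<mu> = Min {e. eigenvalue A e}"
  have A: "A \<in> carrier_mat p p" using H by (simp add: A_def)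
  have sym: "transpose_mat A = A" using H by (simp add: A_def transpose_mult[of _ p q _ p])
  have quad: "z \<bullet> (A *\<^sub>v z) = (H *\<^sub>v z) \<bullet> (H *\<^sub>v z)" if z: "z \<in> carrier_vec p" for z
  proof -
    have "A *\<^sub>v z = transpose_mat H *\<^sub>v (H *\<^sub>v z)" using H z by (simp add: A_def assoc_mult_mat_vec[of _ p q _ p])
    hence "z \<bullet> (A *\<^sub>v z) = (transpose_mat H *\<^sub>v (H *\<^sub>v z)) \<bullet> z"
      using comm_scalar_prod[OF z mult_mat_vec_carrier[OF A z]] by metis
    also have "\<dots> = (H *\<^sub>v z) \<bullet> (H *\<^sub>v z)"
      by (rule transpose_vec_mult_scalar[OF H z mult_mat_vec_carrier[OF H z]])
    finally show ?thesis .
  qed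
  have ker: "z = 0\<^sub>v p" if z: "z \<in> carrier_vec p" and Az: "A *\<^sub>v z = 0\<^sub>v p" for z
  proof (rule inj[OF z])
    have "(H *\<^sub>v z) \<bullet> (H *\<^sub>v z) = 0" using quad[OF z] Az z by simp
    thus "H *\<^sub>v z = 0\<^sub>v q" using scalar_prod_self_eq_0_iff[of "H *\<^sub>v z" q] H z by simp
  qed
  have ev: "{e. eigenvalue A e} = (\<lambda>i. eig_desc A (Suc i)) ` {..<p}"
    by (rule eigenvalues_eq_eig_desc[OF A sym])
  have fin: "finite {e. eigenvalue A e}" and ne: "{e. eigenvalue A e} \<noteq> {}"
    unfolding ev using p by auto
  have "eigenvalue A \<mu>" using Min_in[OF fin ne] by (simp add: \<mu>_def)
  have "0 \<le> \<mu>"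
  proof -
    have "\<mu> \<in> (\<lambda>i. eig_desc A (Suc i)) ` {..<p}" using \<open>eigenvalue A \<mu>\<close> ev by blast
    thus ?thesis using eig_desc_nonneg[OF A sym] quad scalar_prod_self_ge_0 by auto
  qed
  \<comment> \<open>A zero eigenvalue would give a nonzero kernel vector of the Gram matrix, hence
    of \<open>H\<close>, against injectivity.\<close>
  moreover have "\<mu> \<noteq> 0"
  proof
    assume "\<mu> = 0"
    then obtain v where v: "v \<in> carrier_vec p" "v \<noteq> 0\<^sub>v p" "A *\<^sub>v v = 0 \<cdot>\<^sub>v v"
      using \<open>eigenvalue A \<mu>\<close> A unfolding eigenvalue_def eigenvector_def by auto
    have "A *\<^sub>v v = 0\<^sub>v p" unfolding v(3) using v(1) by (intro eq_vecI) auto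
    thus False using ker v(1,2) by blast
  qed
  ultimately have \<mu>: "0 < \<mu>" by simp
  have s: "s_min H = sqrt \<mu>" by (simp add: s_min_def \<mu>_def A_def)
  show "0 < s_min H" using \<mu> by (simp add: s)
  fix a assume a: "a < p"
  have "Determinant.det A \<noteq> 0" using det_0_iff_vec_prod_zero_field[OF A] ker by auto
  then obtain B where B: "A * B = 1\<^sub>m p" "B \<in> carrier_mat p p"
    using det_non_zero_imp_unit[OF A, of "()"] by (auto simp: Units_def ring_mat_def)
  define y where "y = B *\<^sub>v unit_vec p a"
  have y: "y \<in> carrier_vec p" using B by (simp add: y_def)
  have Ay: "A *\<^sub>v y = unit_vec p a"
    unfolding y_def using A B
    by (simp add: assoc_mult_mat_vec[of _ p p _ p, symmetric] del: assoc_mult_mat_vec)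
  define x where "x = H *\<^sub>v y"
  have x: "x \<in> carrier_vec q" using H y by (simp add: x_def)
  have HTx: "transpose_mat H *\<^sub>v x = unit_vec p a"
    using Ay H y by (simp add: A_def x_def assoc_mult_mat_vec[of _ p q _ p])
  have "col H b \<bullet> x = (if b = a then 1 else 0)" if "b < p" for b
  proof -
    have "col H b \<bullet> x = (transpose_mat H *\<^sub>v x) $ b" using H that by simp
    thus ?thesis using that a by (simp add: HTx)
  qed
  \<comment> \<open>Here \<open>x \<bullet> x = y \<bullet> A y = y $ a\<close>. Bounding the form
    below by \<mu> and \<open>y \<bullet> y\<close> below by \<open>(y $ a)^2\<close> gives \<mu>
    times \<open>(y $ a)^2\<close> at most \<open>y $ a\<close>; dividing by \<open>y $ a\<close>
    finishes unless it vanishes.\<close>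
  moreover have "\<mu> * (x \<bullet> x) \<le> 1"
  proof -
    obtain u where u: "\<And>i. i < p \<Longrightarrow> u i \<in> carrier_vec p"
      and orth: "\<And>i j. i < p \<Longrightarrow> j < p \<Longrightarrow> u i \<bullet> u j = (if i = j then 1 else 0)"
      and xx: "\<And>x. x \<in> carrier_vec p \<Longrightarrow> x \<bullet> x = (\<Sum>i<p. (u i \<bullet> x)\<^sup>2)"
      and xAx: "\<And>x. x \<in> carrier_vec p \<Longrightarrow> x \<bullet> (A *\<^sub>v x) = (\<Sum>i<p. eig_desc A (Suc i) * (u i \<bullet> x)\<^sup>2)"
      by (rule eig_desc_eigenbasis[OF A sym]) (rule that)
    have "\<mu> * (y \<bullet> y) \<le> y \<bullet> (A *\<^sub>v y)"
      unfolding xx[OF y] xAx[OF y] sum_distrib_left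
    proof (intro sum_mono mult_right_mono)
      fix i assume "i \<in> {..<p}"
      thus "\<mu> \<le> eig_desc A (Suc i)"
        unfolding \<mu>_def by (intro Min_le[OF fin]) (auto simp: ev)
    qed auto
    also have yAy: "y \<bullet> (A *\<^sub>v y) = y $ a" using y a by (simp add: Ay)
    finally have 1: "\<mu> * (y \<bullet> y) \<le> y $ a" .
    have "(y $ a)\<^sup>2 \<le> y \<bullet> y"
      using scalar_prod_cauchy_schwarz[OF y unit_vec_carrier[of p a]] y a by simp
    hence "\<mu> * (y $ a)\<^sup>2 \<le> y $ a" using 1 \<mu> by (smt (verit) mult_left_mono)
    moreover have "x \<bullet> x = y $ a" using quad[OF y] yAy by (simp add: x_def)
    moreover have "0 \<le> x \<bullet> x" by (rule scalar_prod_self_ge_0)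
    ultimately have ya: "\<mu> * (y $ a) * (y $ a) \<le> 1 * (y $ a)" "0 \<le> y $ a" "x \<bullet> x = y $ a"
      by (simp_all add: power2_eq_square mult.assoc)
    show ?thesis
    proof (cases "y $ a = 0")
      case False
      thus ?thesis using mult_right_le_imp_le[OF ya(1)] ya(2,3) by simp
    qed (use ya in simp)
  qed
  ultimately show "\<exists>x\<in>carrier_vec q. (\<forall>b<p. col H b \<bullet> x = (if b = a then 1 else 0)) \<and>
      (s_min H)\<^sup>2 * (x \<bullet> x) \<le> 1"
    using x \<mu> by (intro bexI[of _ x]) (auto simp: s)
qed

lemma G_large_carrier:
  assumes "G \<in> carrier_mat q N"
  shows "G_large G r M \<in> carrier_mat q (card (large_idx N r M))"
proof -
  have "{j. j < N \<and> j \<in> large_idx N r M} = large_idx N r M" by (auto simp: large_idx_def)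
  thus ?thesis using assms unfolding G_large_def by (intro carrier_matI) (simp_all add: dim_submatrix)
qed

text \<open>A submatrix keeps the selected columns in increasing order, so column \<open>j\<close>
  sits at the position counting the selected indices below it.\<close>

lemma col_G_large:
  assumes G: "G \<in> carrier_mat q N" and j: "j \<in> large_idx N r M"
  shows "card {i \<in> large_idx N r M. i < j} < card (large_idx N r M)"
    and "col (G_large G r M) (card {i \<in> large_idx N r M. i < j}) = col G j"
proof -
  let ?I = "large_idx N r M"
  have fin: "finite ?I" by (simp add: large_idx_def)
  have IN: "{j. j < N \<and> j \<in> ?I} = ?I" by (auto simp: large_idx_def)
  define a where "a = card {i \<in> ?I. i < j}"
  have "{i \<in> ?I. i < j} \<subset> ?I" using j by auto
  hence a: "a < card ?I" unfolding a_def by (rule psubset_card_mono[OF fin])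
  show "card {i \<in> ?I. i < j} < card ?I" using a by (simp add: a_def)
  show "col (G_large G r M) (card {i \<in> ?I. i < j}) = col G j"
    unfolding a_def[symmetric]
  proof (rule eq_vecI)
    fix i assume "i < dim_vec (col G j)"
    hence i: "i < q" using G by simp
    have "G_large G r M $$ (i, a) = G $$ (pick UNIV i, pick ?I a)"
      unfolding G_large_def using G i a IN by (subst submatrix_index) auto
    also have "\<dots> = G $$ (i, j)" using pick_card_in_set[OF j] by (simp add: a_def pick_UNIV)
    finally show "col (G_large G r M) a $ i = col G j $ i"
      using i a G j G_large_carrier[OF G, of r M] by (simp add: large_idx_def)
  qed (use G G_large_carrier[OF G, of r M] in simp)
qed

section \<open>Quadratic forms of the full and the truncated matrix\<close>

lemma S_full_carrier: "G \<in> carrier_mat q N \<Longrightarrow> S_full G r \<in> carrier_mat q q"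
  by (simp add: S_full_def)

lemma S_trunc_carrier: "G \<in> carrier_mat q N \<Longrightarrow> S_trunc G r K \<in> carrier_mat q q"
  by (simp add: S_trunc_def)

lemma transpose_smult_weighted_gram:
  "transpose_mat (c \<cdot>\<^sub>m weighted_gram G r J) = c \<cdot>\<^sub>m weighted_gram G r J"
  by (rule eq_matI) (auto simp: weighted_gram_def mult_ac)

lemma transpose_S_full: "transpose_mat (S_full G r) = S_full G r"
  by (simp add: S_full_def transpose_smult_weighted_gram)

lemma transpose_S_trunc: "transpose_mat (S_trunc G r K) = S_trunc G r K"
  by (simp add: S_trunc_def transpose_smult_weighted_gram)

lemma smult_weighted_gram_quadratic_form:
  assumes G: "G \<in> carrier_mat q N" and x: "x \<in> carrier_vec q"
  shows "x \<bullet> ((c \<cdot>\<^sub>m weighted_gram G r J) *\<^sub>v x) = c * (\<Sum>j\<in>J. r j * (col G j \<bullet> x)\<^sup>2)"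
proof -
  have W: "weighted_gram G r J \<in> carrier_mat q q" using G by simp
  have "(c \<cdot>\<^sub>m weighted_gram G r J) *\<^sub>v x = c \<cdot>\<^sub>v (weighted_gram G r J *\<^sub>v x)"
    using W x by (intro eq_vecI) auto
  thus ?thesis
    using scalar_prod_smult_distrib[OF x mult_mat_vec_carrier[OF W x]] weighted_gram_quadratic_form[OF G x] by simp
qed

lemma S_full_quadratic_form:
  assumes "G \<in> carrier_mat q N" "x \<in> carrier_vec q"
  shows "x \<bullet> (S_full G r *\<^sub>v x) = 1 / real N * (\<Sum>j<N. r j * (col G j \<bullet> x)\<^sup>2)"
proof -
  have "{j. j < N} = {..<N}" by auto
  thus ?thesis
    using smult_weighted_gram_quadratic_form[OF assms, of "1 / real N" r "{..<N}"] assms(1)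
    by (simp only: S_full_def carrier_matD)
qed

lemma S_trunc_quadratic_form:
  assumes "G \<in> carrier_mat q N" "x \<in> carrier_vec q"
  shows "x \<bullet> (S_trunc G r K *\<^sub>v x) = 1 / real N * (\<Sum>j | j < N \<and> r j \<le> K. r j * (col G j \<bullet> x)\<^sup>2)"
  using smult_weighted_gram_quadratic_form[OF assms, of "1 / real N" r "{j. j < N \<and> r j \<le> K}"] assms(1)
  by (simp only: S_trunc_def carrier_matD)

lemma eig_desc_S_full_nonneg:
  assumes G: "G \<in> carrier_mat q N" and r: "\<And>j. j < N \<Longrightarrow> 0 \<le> r j" and i: "i < q"
  shows "0 \<le> eig_desc (S_full G r) (Suc i)"
proof (rule eig_desc_nonneg[OF S_full_carrier[OF G] transpose_S_full _ i])
  show "0 \<le> x \<bullet> (S_full G r *\<^sub>v x)" if "x \<in> carrier_vec q" for x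
    unfolding S_full_quadratic_form[OF G that] using r by (intro mult_nonneg_nonneg sum_nonneg) auto
qed

section \<open>Upper bound for the product of the top eigenvalues\<close>

lemma sum_col_scalar_prod_squared_le:
  assumes G: "G \<in> carrier_mat q N" and x: "x \<in> carrier_vec q"
  shows "(\<Sum>j<N. (col G j \<bullet> x)\<^sup>2) \<le> (op_norm G)\<^sup>2 * (x \<bullet> x)"
proof -
  have "(transpose_mat G *\<^sub>v x) \<bullet> (transpose_mat G *\<^sub>v x) = (\<Sum>j<N. (col G j \<bullet> x)\<^sup>2)"
    using G by (simp add: scalar_prod_def[of "transpose_mat G *\<^sub>v x"] power2_eq_square atLeast0LessThan)
  thus ?thesis using transpose_mult_vec_le_op_norm[OF G x] by simp
qed

lemma finite_large_idx [simp]: "finite (large_idx N r K)"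
  by (simp add: large_idx_def)

text \<open>Orthogonality to the columns in \<open>V\<close> costs at most \<open>i\<close>
  constraints and leaves only weights up to \<open>c\<close>; pulling \<open>c\<close> out leaves
  the form bounded by the squared norm of \<open>G\<close>.\<close>

lemma eig_desc_S_full_le:
  assumes G: "G \<in> carrier_mat q N" and r: "\<And>j. j < N \<Longrightarrow> 0 \<le> r j"
    and V: "V \<subseteq> {..<N}" "card V \<le> i" and i: "i < q"
    and le: "\<And>j. j < N \<Longrightarrow> j \<notin> V \<Longrightarrow> r j \<le> c" and c: "0 \<le> c"
  shows "eig_desc (S_full G r) (Suc i) \<le> c * (op_norm G)\<^sup>2 / real N"
proof (rule eig_desc_le[OF S_full_carrier[OF G] transpose_S_full, of "col G ` V"])
  have fin: "finite V" using V(1) finite_subset by blast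
  show "finite (col G ` V)" using fin by simp
  show "col G ` V \<subseteq> carrier_vec q" using G by (auto intro: carrier_vecI)
  show "card (col G ` V) \<le> i" using card_image_le[OF fin, of "col G"] V(2) by simp
  fix x :: "real vec" assume x: "x \<in> carrier_vec q" and orth: "\<And>v. v \<in> col G ` V \<Longrightarrow> v \<bullet> x = 0"
  have "(\<Sum>j<N. r j * (col G j \<bullet> x)\<^sup>2) \<le> (\<Sum>j<N. c * (col G j \<bullet> x)\<^sup>2)"
  proof (rule sum_mono)
    fix j assume "j \<in> {..<N}"
    thus "r j * (col G j \<bullet> x)\<^sup>2 \<le> c * (col G j \<bullet> x)\<^sup>2"
      using le orth by (cases "j \<in> V") (auto intro: mult_right_mono)
  qed
  also have "\<dots> \<le> c * ((op_norm G)\<^sup>2 * (x \<bullet> x))"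
    unfolding sum_distrib_left[symmetric] by (intro mult_left_mono sum_col_scalar_prod_squared_le[OF G x] c)
  finally show "x \<bullet> (S_full G r *\<^sub>v x) \<le> c * (op_norm G)\<^sup>2 / real N * (x \<bullet> x)"
    unfolding S_full_quadratic_form[OF G x] by (simp add: divide_right_mono)
qed (rule i)

lemma prod_eig_desc_S_full_le:
  assumes G: "G \<in> carrier_mat q N" and r: "\<And>j. j < N \<Longrightarrow> 0 \<le> r j" and t: "0 < t" and K: "0 \<le> K"
    and card: "card (large_idx N r K) \<le> q"
  shows "(\<Prod>i<card (large_idx N r K). 1 + eig_desc (S_full G r) (Suc i) / t)
    \<le> (\<Prod>j\<in>large_idx N r K. sigma_upper G t * (1 + r j))"
proof -
  let ?L = "large_idx N r K" and ?d = "\<lambda>i. eig_desc (S_full G r) (Suc i)"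
  \<comment> \<open>The heavy indices by decreasing weight. The first \<open>i\<close> of them are
    removed to bound the eigenvalue with index \<open>Suc i\<close>, so the heaviest remaining
    weight is \<open>r (ls ! i)\<close>.\<close>
  define ls where "ls = rev (sort_key r (sorted_list_of_set ?L))"
  have ls: "set ls = ?L" "distinct ls" "length ls = card ?L"
    by (simp_all add: ls_def)
  have "sorted_wrt (\<ge>) (map r ls)"
    by (simp add: ls_def rev_map[symmetric] sorted_wrt_rev)
  hence desc: "r (ls ! m) \<le> r (ls ! i)" if "i \<le> m" "m < card ?L" for i m
    using that ls(3) by (cases "i = m") (auto simp: sorted_wrt_iff_nth_less)
  have upper: "1 \<le> sigma_upper G t" "(op_norm G)\<^sup>2 / (real N * t) \<le> sigma_upper G t"
    using G by (auto simp: sigma_upper_def)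
  have d_le: "1 + ?d i / t \<le> sigma_upper G t * (1 + r (ls ! i))" if i: "i < card ?L" for i
  proof -
    have mem: "ls ! i \<in> ?L" using i ls by (metis nth_mem)
    hence ri: "K < r (ls ! i)" by (simp add: large_idx_def)
    have "?d i \<le> r (ls ! i) * (op_norm G)\<^sup>2 / real N"
    proof (rule eig_desc_S_full_le[OF G r, where V = "set (take i ls)"])
      show "set (take i ls) \<subseteq> {..<N}" using ls(1) set_take_subset[of i ls] by (auto simp: large_idx_def)
      show "card (set (take i ls)) \<le> i" using card_length[of "take i ls"] by simp
      fix j assume j: "j < N" "j \<notin> set (take i ls)"
      show "r j \<le> r (ls ! i)"
      proof (cases "j \<in> ?L")
        case True
        then obtain m where m: "m < card ?L" "j = ls ! m" using ls by (metis in_set_conv_nth)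
        hence "i \<le> m" using j(2) ls(3) by (metis in_set_conv_nth leI length_take min_less_iff_conj nth_take)
        thus ?thesis using desc m by simp
      next
        case False
        thus ?thesis using j(1) ri by (simp add: large_idx_def)
      qed
    qed (use i card K ri in auto)
    hence "?d i / t \<le> r (ls ! i) * (op_norm G)\<^sup>2 / real N / t"
      using t by (intro divide_right_mono) auto
    also have "\<dots> = r (ls ! i) * ((op_norm G)\<^sup>2 / (real N * t))" by simp
    also have "\<dots> \<le> r (ls ! i) * sigma_upper G t"
      using upper K ri by (intro mult_left_mono) auto
    \<comment> \<open>The constant term 1 is absorbed because \<open>sigma_upper\<close> is at least
      1.\<close>
    finally show ?thesis using upper(1) by (simp add: algebra_simps)
  qed
  have "(\<Prod>i<card ?L. 1 + ?d i / t) \<le> (\<Prod>i<card ?L. sigma_upper G t * (1 + r (ls ! i)))"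
  proof (rule prod_mono, safe)
    fix i assume i: "i < card ?L"
    have "0 \<le> ?d i" using i card by (intro eig_desc_S_full_nonneg[OF G r]) auto
    thus "0 \<le> 1 + ?d i / t" using t by simp
  qed (use d_le in auto)
  \<comment> \<open>Only the product over all heavy indices remains, and the sorting drops
    out.\<close>
  also have "\<dots> = (\<Prod>j\<in>?L. sigma_upper G t * (1 + r j))"
    by (rule prod.reindex_bij_betw[OF bij_betw_nth[OF ls(2) _ ls(1)[symmetric]]]) (simp add: ls(3))
  finally show ?thesis .
qed

section \<open>Lower bound for the growth of the determinant\<close>

lemma one_plus_smult_S_full:
  assumes "G \<in> carrier_mat q N"
  shows "1\<^sub>m q + (1 / t) \<cdot>\<^sub>m S_full G r = 1\<^sub>m q + (1 / (real N * t)) \<cdot>\<^sub>m weighted_gram G r {j. j < N}"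
  using assms by (intro eq_matI) (auto simp: S_full_def weighted_gram_def)

lemma one_plus_smult_S_trunc:
  assumes "G \<in> carrier_mat q N"
  shows "1\<^sub>m q + (1 / t) \<cdot>\<^sub>m S_trunc G r K =
    1\<^sub>m q + (1 / (real N * t)) \<cdot>\<^sub>m weighted_gram G r {j. j < N \<and> r j \<le> K}"
  using assms by (intro eq_matI) (auto simp: S_trunc_def weighted_gram_def)

lemma C0_quadratic_form:
  assumes G: "G \<in> carrier_mat q N" and x: "x \<in> carrier_vec q"
  shows "x \<bullet> (C0 G r t M *\<^sub>v x) =
    x \<bullet> x + 1 / (real N * t) * (\<Sum>j | j < N \<and> r j \<le> M. r j * (col G j \<bullet> x)\<^sup>2)"
  using one_plus_smult_quadratic_form[OF weighted_gram_carrier[OF G] x] G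
  by (simp only: C0_def carrier_matD weighted_gram_quadratic_form[OF G x])

text \<open>At a unit vector the form of \<open>C0\<close> is at least 1, and it is at most the
  operator norm. This makes the denominator in \<open>sigma_lower\<close> positive.\<close>

lemma op_norm_C0_pos:
  assumes G: "G \<in> carrier_mat q N" and q: "1 \<le> q" and t: "0 < t" and r: "\<And>j. j < N \<Longrightarrow> 0 \<le> r j"
  shows "0 < op_norm (C0 G r t M)"
proof -
  let ?e = "unit_vec q 0 :: real vec"
  have e: "?e \<in> carrier_vec q" "?e \<bullet> ?e = 1" using q by auto
  have C: "C0 G r t M \<in> carrier_mat q q" using G by (simp add: C0_def)
  have "1 \<le> ?e \<bullet> (C0 G r t M *\<^sub>v ?e)"
    unfolding C0_quadratic_form[OF G e(1)] e(2) using r t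
    by (auto intro!: mult_nonneg_nonneg sum_nonneg divide_nonneg_nonneg)
  also have "\<dots> \<le> op_norm (C0 G r t M) * (?e \<bullet> ?e)" by (rule quadratic_form_le_op_norm[OF C e(1)])
  finally show ?thesis using e(2) by simp
qed

lemma full_rank_s_min_pos:
  assumes G: "G \<in> carrier_mat q N" and ne: "large_idx N r M \<noteq> {}"
    and rank: "vec_space.rank q (G_large G r M) = card (large_idx N r M)"
  shows "0 < s_min (G_large G r M)"
proof -
  have p: "0 < card (large_idx N r M)" using ne by (simp add: card_gt_0_iff)
  show ?thesis
    by (rule s_min_dual_basis(1)[OF G_large_carrier[OF G] p full_column_rank_inj[OF G_large_carrier[OF G] rank]])
qed

text \<open>Carries the dual vectors of the submatrix over from column positions to the original
  indices.\<close>

lemma full_rank_dual_vector: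
  assumes G: "G \<in> carrier_mat q N" and j: "j \<in> large_idx N r M"
    and rank: "vec_space.rank q (G_large G r M) = card (large_idx N r M)"
  obtains x where "x \<in> carrier_vec q" "col G j \<bullet> x = 1"
    "\<And>i. i \<in> large_idx N r M \<Longrightarrow> i \<noteq> j \<Longrightarrow> col G i \<bullet> x = 0"
    "(s_min (G_large G r M))\<^sup>2 * (x \<bullet> x) \<le> 1"
proof -
  let ?I = "large_idx N r M" and ?H = "G_large G r M"
  let ?pos = "\<lambda>i. card {l \<in> large_idx N r M. l < i}"
  note pos = col_G_large[OF G, of _ r M]
  have "0 < card ?I" using j by (auto simp: card_gt_0_iff)
  from s_min_dual_basis(2)[OF G_large_carrier[OF G] this full_column_rank_inj[OF G_large_carrier[OF G] rank] pos(1)[OF j]]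
  obtain x where x: "x \<in> carrier_vec q" "\<And>b. b < card ?I \<Longrightarrow> col ?H b \<bullet> x = (if b = ?pos j then 1 else 0)"
    "(s_min ?H)\<^sup>2 * (x \<bullet> x) \<le> 1"
    by blast
  show thesis
  proof (rule that[OF x(1) _ _ x(3)])
    show "col G j \<bullet> x = 1" using x(2)[OF pos(1)[OF j]] pos(2)[OF j] by simp
    fix i assume i: "i \<in> ?I" "i \<noteq> j"
    \<comment> \<open>An index is recovered from its position by \<open>pick\<close>, so distinct
      heavy indices have distinct positions.\<close>
    have "?pos i \<noteq> ?pos j" using i j pick_card_in_set by metis
    thus "col G i \<bullet> x = 0" using x(2)[OF pos(1)[OF i(1)]] pos(2)[OF i(1)] by simp
  qed
qed

text \<open>Full rank makes \<open>s_min\<close> positive and the norm of \<open>C0\<close> is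
  positive; the logarithm of the quotient in the final bound relies on this.\<close>

lemma sigma_lower_pos:
  assumes G: "G \<in> carrier_mat q N" and q: "1 \<le> q" and t: "0 < t" and N: "1 \<le> N"
    and r: "\<And>j. j < N \<Longrightarrow> 0 \<le> r j"
    and rank: "large_idx N r M \<noteq> {} \<Longrightarrow> vec_space.rank q (G_large G r M) = card (large_idx N r M)"
  shows "0 < sigma_lower G r t M"
proof (cases "large_idx N r M = {}")
  case False
  have "0 < (s_min (G_large G r M))\<^sup>2 / (real N * t * op_norm (C0 G r t M))"
    using full_rank_s_min_pos[OF G False rank[OF False]] op_norm_C0_pos[where r = r and M = M, OF G q t r] t N
    by (intro divide_pos_pos mult_pos_pos) auto
  thus ?thesis using False G by (simp add: sigma_lower_def)
qed (use G in \<open>simp add: sigma_lower_def\<close>)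

text \<open>Every column with weight above \<open>K\<close> is added to the truncated matrix with a
  dual vector that annihilates all other columns with weight above \<open>M\<close>. Its form is
  therefore that of \<open>C0\<close>, whatever the heavy weights are.\<close>

lemma det_one_plus_S_trunc_le:
  assumes G: "G \<in> carrier_mat q N" and q: "1 \<le> q" and t: "0 < t" and N: "1 \<le> N"
    and r: "\<And>j. j < N \<Longrightarrow> 0 \<le> r j"
    and rank: "large_idx N r M \<noteq> {} \<Longrightarrow> vec_space.rank q (G_large G r M) = card (large_idx N r M)"
    and K: "M \<le> K"
  shows "Determinant.det (1\<^sub>m q + (1 / t) \<cdot>\<^sub>m S_trunc G r K) *
      (\<Prod>j\<in>large_idx N r K. sigma_lower G r t M * (1 + r j))
    \<le> Determinant.det (1\<^sub>m q + (1 / t) \<cdot>\<^sub>m S_full G r)"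
proof (cases "large_idx N r K = {}")
  case True
  hence "r j \<le> K" if "j < N" for j using that by (simp add: large_idx_def set_eq_iff) (metis not_le)
  hence "{j. j < N \<and> r j \<le> K} = {j. j < N}" by auto
  thus ?thesis by (simp add: True S_full_def S_trunc_def) (use G in simp)
next
  case False
  let ?I = "large_idx N r M" and ?L = "large_idx N r K" and ?J = "{j. j < N \<and> r j \<le> K}"
  let ?c = "1 / (real N * t)"
  define s where "s = s_min (G_large G r M)"
  define \<kappa> where "\<kappa> = op_norm (C0 G r t M)"
  have LI: "?L \<subseteq> ?I" using K by (auto simp: large_idx_def)
  hence ne: "?I \<noteq> {}" using False by auto
  note rank = rank[OF ne]
  have \<kappa>: "0 < \<kappa>" unfolding \<kappa>_def by (rule op_norm_C0_pos[OF G q t r])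
  have c: "0 \<le> ?c" using t by simp
  \<comment> \<open>The dual vector has form at most \<kappa> times its squared norm, and
    \<open>s^2\<close> times that squared norm is at most 1; hence this \<open>w\<close> is
    admissible for every column at once.\<close>
  define w where "w = s\<^sup>2 / \<kappa>"
  have w: "0 \<le> w" using \<kappa> by (simp add: w_def)
  have low: "sigma_lower G r t M \<le> 1" "sigma_lower G r t M \<le> ?c * w"
    using ne G by (auto simp: sigma_lower_def w_def s_def \<kappa>_def mult_ac)
  have JL: "?J \<union> ?L = {j. j < N}" "?J \<inter> ?L = {}" by (auto simp: large_idx_def)
  have rJL: "0 \<le> r j" if "j \<in> ?J \<union> ?L" for j using that r JL(1) by auto
  have det1: "0 \<le> Determinant.det (1\<^sub>m q + ?c \<cdot>\<^sub>m weighted_gram G r ?J)"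
    using det_one_plus_weighted_gram_ge_1[OF G c, of ?J r] r by fastforce
  have lownn: "0 \<le> sigma_lower G r t M"
    by (rule less_imp_le, rule sigma_lower_pos[OF G q t N r rank])
  have "Determinant.det (1\<^sub>m q + ?c \<cdot>\<^sub>m weighted_gram G r ?J) * (\<Prod>j\<in>?L. sigma_lower G r t M * (1 + r j))
    \<le> Determinant.det (1\<^sub>m q + ?c \<cdot>\<^sub>m weighted_gram G r ?J) * (\<Prod>j\<in>?L. 1 + ?c * r j * w)"
  proof (intro mult_left_mono[OF _ det1] prod_mono conjI)
    fix j assume j: "j \<in> ?L"
    hence rj: "0 \<le> r j" using r by (simp add: large_idx_def)
    show "0 \<le> sigma_lower G r t M * (1 + r j)" using lownn rj by simp
    \<comment> \<open>The two bounds in \<open>low\<close> serve the two summands of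
      \<open>1 + r j\<close>, which explains the minimum in \<open>sigma_lower\<close>.\<close>
    have "sigma_lower G r t M * r j \<le> ?c * w * r j" by (intro mult_right_mono low(2) rj)
    thus "sigma_lower G r t M * (1 + r j) \<le> 1 + ?c * r j * w"
      using low(1) by (simp add: algebra_simps)
  qed
  also have "\<dots> \<le> Determinant.det (1\<^sub>m q + ?c \<cdot>\<^sub>m weighted_gram G r (?J \<union> ?L))"
  proof (rule det_one_plus_weighted_gram_Un_ge[OF G c w _ _ JL(2) rJL])
    fix j assume jL: "j \<in> ?L"
    hence j: "j \<in> ?I" using LI by auto
    obtain x where x: "x \<in> carrier_vec q" "col G j \<bullet> x = 1"
      "\<And>i. i \<in> ?I \<Longrightarrow> i \<noteq> j \<Longrightarrow> col G i \<bullet> x = 0" "s\<^sup>2 * (x \<bullet> x) \<le> 1"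
      by (rule full_rank_dual_vector[OF G j rank]) (auto simp: s_def intro: that)
    \<comment> \<open>Apart from the excluded \<open>j\<close>, all indices with weight above
      \<open>M\<close> drop out, including those with weight between \<open>M\<close> and
      \<open>K\<close> that already belong to \<open>?J\<close>.\<close>
    have "(\<Sum>i\<in>?J \<union> ?L - {j}. r i * (col G i \<bullet> x)\<^sup>2) = (\<Sum>i | i < N \<and> r i \<le> M. r i * (col G i \<bullet> x)\<^sup>2)"
      unfolding JL(1) using j x(3)
      by (intro sum.mono_neutral_right) (auto simp: large_idx_def not_le)
    hence "x \<bullet> x + ?c * (\<Sum>i\<in>?J \<union> ?L - {j}. r i * (col G i \<bullet> x)\<^sup>2) = x \<bullet> (C0 G r t M *\<^sub>v x)"
      by (simp add: C0_quadratic_form[OF G x(1)])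
    also have "\<dots> \<le> \<kappa> * (x \<bullet> x)"
      unfolding \<kappa>_def using G x(1) by (intro quadratic_form_le_op_norm) (auto simp: C0_def)
    finally have "w * (x \<bullet> x + ?c * (\<Sum>i\<in>?J \<union> ?L - {j}. r i * (col G i \<bullet> x)\<^sup>2)) \<le> w * (\<kappa> * (x \<bullet> x))"
      using w by (intro mult_left_mono)
    also have "\<dots> = s\<^sup>2 * (x \<bullet> x)" using \<kappa> by (simp add: w_def)
    also have "\<dots> \<le> 1" by (rule x(4))
    finally show "\<exists>x\<in>carrier_vec q. col G j \<bullet> x = 1 \<and>
        w * (x \<bullet> x + ?c * (\<Sum>i\<in>?J \<union> ?L - {j}. r i * (col G i \<bullet> x)\<^sup>2)) \<le> 1"
      using x(1,2) by blast
  qed auto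
  finally show ?thesis
    unfolding one_plus_smult_S_full[OF G] one_plus_smult_S_trunc[OF G] JL(1) .
qed

section \<open>Lower eigenvalues and the passage to logarithms\<close>

lemma prod_eig_desc_S_full_tail_le:
  assumes G: "G \<in> carrier_mat q N" and t: "0 < t" and r: "\<And>j. j < N \<Longrightarrow> 0 \<le> r j"
    and k: "k = card (large_idx N r K)" "k \<le> q"
  shows "(\<Prod>i\<in>{k..<q}. 1 + eig_desc (S_full G r) (Suc i) / t)
    \<le> Determinant.det (1\<^sub>m q + (1 / t) \<cdot>\<^sub>m S_trunc G r K)"
proof -
  let ?d = "\<lambda>i. eig_desc (S_full G r) (Suc i)" and ?d' = "\<lambda>i. eig_desc (S_trunc G r K) (Suc i)"
  have d0: "0 \<le> ?d i" if "i < q" for i by (rule eig_desc_S_full_nonneg[OF G r that])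
  have d'0: "0 \<le> ?d' i" if "i < q" for i
  proof (rule eig_desc_nonneg[OF S_trunc_carrier[OF G] transpose_S_trunc _ that])
    show "0 \<le> x \<bullet> (S_trunc G r K *\<^sub>v x)" if "x \<in> carrier_vec q" for x
      unfolding S_trunc_quadratic_form[OF G that] using r by (intro mult_nonneg_nonneg sum_nonneg) auto
  qed
  have weyl: "?d (i + k) \<le> ?d' i" if i: "i + k < q" for i
  proof (rule eig_desc_low_rank_perturbation[OF S_trunc_carrier[OF G] transpose_S_trunc
        S_full_carrier[OF G] transpose_S_full, of "col G ` large_idx N r K"])
    show "col G ` large_idx N r K \<subseteq> carrier_vec q" using G by (auto intro: carrier_vecI)
    show "card (col G ` large_idx N r K) \<le> k" unfolding k by (rule card_image_le) simp
    fix x :: "real vec" assume x: "x \<in> carrier_vec q"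
      and orth: "\<And>v. v \<in> col G ` large_idx N r K \<Longrightarrow> v \<bullet> x = 0"
    \<comment> \<open>Orthogonally to the \<open>k\<close> columns with weight above
      \<open>K\<close>, the full and the truncated form coincide.\<close>
    have "(\<Sum>j<N. r j * (col G j \<bullet> x)\<^sup>2) = (\<Sum>j | j < N \<and> r j \<le> K. r j * (col G j \<bullet> x)\<^sup>2)"
      using orth by (intro sum.mono_neutral_right) (auto simp: large_idx_def not_le)
    thus "x \<bullet> (S_full G r *\<^sub>v x) \<le> x \<bullet> (S_trunc G r K *\<^sub>v x)"
      by (simp add: S_full_quadratic_form[OF G x] S_trunc_quadratic_form[OF G x])
  qed (use i in auto)
  have "(\<Prod>i\<in>{k..<q}. 1 + ?d i / t) = (\<Prod>i<q - k. 1 + ?d (i + k) / t)"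
    using prod.shift_bounds_nat_ivl[of "\<lambda>i. 1 + ?d i / t" 0 k "q - k"] k(2) by (simp add: atLeast0LessThan)
  also have "\<dots> \<le> (\<Prod>i<q - k. 1 + ?d' i / t)"
    using d0 weyl t by (intro prod_mono) (auto intro!: divide_right_mono)
  \<comment> \<open>The \<open>k\<close> factors added are at least 1, because the truncated matrix
    is positive semidefinite.\<close>
  also have "\<dots> \<le> (\<Prod>i<q. 1 + ?d' i / t)"
    using d'0 t by (intro prod_mono2) auto
  also have "\<dots> = Determinant.det (1\<^sub>m q + (1 / t) \<cdot>\<^sub>m S_trunc G r K)"
    using det_one_plus_smult_eig_desc[OF S_trunc_carrier[OF G] transpose_S_trunc, of "1 / t"] by simp
  finally show ?thesis .
qed

text \<open>\<open>C0\<close> involves only the weights up to \<open>M\<close>, and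
  \<open>G_large\<close> depends on the weights only through the index set; the sizes of the heavy
  weights never enter.\<close>

lemma sigma_lower_cong:
  assumes "large_idx (dim_col G) r' M = large_idx (dim_col G) r M"
    and "\<forall>j<dim_col G. r j \<le> M \<longrightarrow> r' j = r j"
  shows "sigma_lower G r' t M = sigma_lower G r t M"
proof -
  have eq: "r' j \<le> M \<longleftrightarrow> r j \<le> M" if "j < dim_col G" for j
  proof -
    have "j \<in> large_idx (dim_col G) r' M \<longleftrightarrow> j \<in> large_idx (dim_col G) r M" using assms(1) by simp
    thus ?thesis using that by (simp add: large_idx_def) linarith
  qed
  hence "{j. j < dim_col G \<and> r' j \<le> M} = {j. j < dim_col G \<and> r j \<le> M}" by auto
  hence "C0 G r' t M = C0 G r t M"
    unfolding C0_def weighted_gram_def using assms(2)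
    by (auto intro!: arg_cong2[where f = "(+)"] arg_cong2[where f = "(\<cdot>\<^sub>m)"] cong_mat sum.cong)
  thus ?thesis by (simp add: sigma_lower_def G_large_def assms(1))
qed

text \<open>The third conjunct makes precise that the bound does not depend on the largest weight:
  the weights above \<open>M\<close> may be changed as long as the set of indices above
  \<open>M\<close> and the number of weights above \<open>K\<close> stay the same.\<close>

theorem lemma6p4:
  fixes q N k :: nat and r :: "nat \<Rightarrow> real" and t M K :: real and G :: "real mat"
  assumes "q \<ge> 1" and "N \<ge> 1"
    and "\<And>j. j < N \<Longrightarrow> r j \<ge> 0"
    and "t > 0"
    and "G \<in> carrier_mat q N"
    and "M > 0"
    and "card (large_idx N r M) \<le> q"
    and "large_idx N r M \<noteq> {} \<Longrightarrow> vec_space.rank q (G_large G r M) = card (large_idx N r M)"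
    and "K \<ge> M"
    and "k = card (large_idx N r K)"
  shows "0 \<le> ln (Determinant.det (1\<^sub>m q + (1 / t) \<cdot>\<^sub>m S_trunc G r K))
             - (\<Sum>i=k+1..q. ln (1 + eig_desc (S_full G r) i / t))
       \<and> ln (Determinant.det (1\<^sub>m q + (1 / t) \<cdot>\<^sub>m S_trunc G r K))
             - (\<Sum>i=k+1..q. ln (1 + eig_desc (S_full G r) i / t))
           \<le> real k * ln (sigma_upper G t / sigma_lower G r t M)
       \<and> (\<forall>r'. large_idx N r' M = large_idx N r M
              \<and> card (large_idx N r' K) = k
              \<and> (\<forall>j<N. r j \<le> M \<longrightarrow> r' j = r j)
            \<longrightarrow> real (card (large_idx N r' K)) * ln (sigma_upper G t / sigma_lower G r' t M)
              = real k * ln (sigma_upper G t / sigma_lower G r t M))"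
proof -
  note q = assms(1) and N = assms(2) and r = assms(3) and t = assms(4) and G = assms(5)
    and rank = assms(8) and K = assms(9) and k = assms(10)
  let ?L = "large_idx N r K" and ?d = "\<lambda>i. eig_desc (S_full G r) (Suc i)"
  define D where "D = Determinant.det (1\<^sub>m q + (1 / t) \<cdot>\<^sub>m S_trunc G r K)"
  \<comment> \<open>The range from \<open>k\<close> to \<open>q - 1\<close>, combined with
    \<open>Suc i\<close> in \<open>?d\<close>, corresponds to the eigenvalues numbered
    \<open>k + 1\<close> to \<open>q\<close>.\<close>
  define T where "T = (\<Prod>i\<in>{k..<q}. 1 + ?d i / t)"
  define a where "a = sigma_lower G r t M"
  define b where "b = sigma_upper G t"
  have kq: "k \<le> q"
    using card_mono[of "large_idx N r M" ?L] K assms(7) k by (auto simp: large_idx_def subset_iff)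
  have a: "0 < a" unfolding a_def by (rule sigma_lower_pos[OF G q t N r rank])
  have b: "1 \<le> b" by (simp add: b_def sigma_upper_def)
  have pos: "0 < 1 + ?d i / t" if "i < q" for i
  proof -
    have "0 \<le> ?d i" by (rule eig_desc_S_full_nonneg[OF G r that])
    thus ?thesis using t by (simp add: add_pos_nonneg)
  qed
  have T: "0 < T" unfolding T_def using pos by (intro prod_pos) auto
  have TD: "T \<le> D" unfolding T_def D_def by (rule prod_eig_desc_S_full_tail_le[OF G t r k kq])
  hence D: "0 < D" using T by linarith
  have "(\<Sum>i=k+1..q. ln (1 + eig_desc (S_full G r) i / t)) = (\<Sum>i\<in>{k..<q}. ln (1 + ?d i / t))"
    using sum.shift_bounds_Suc_ivl[of "\<lambda>i. ln (1 + eig_desc (S_full G r) i / t)" k q]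
    by (simp add: atLeastLessThanSuc_atLeastAtMost)
  also have "\<dots> = ln T"
  proof -
    have "1 + ?d i / t \<noteq> 0" if "i \<in> {k..<q}" for i using pos[of i] that by auto
    thus ?thesis unfolding T_def by (intro ln_prod[symmetric]) auto
  qed
  finally have lnT: "(\<Sum>i=k+1..q. ln (1 + eig_desc (S_full G r) i / t)) = ln T" .
  \<comment> \<open>The determinant of the full matrix is estimated twice: from below by updating
    the truncated one, and from above by splitting its eigenvalues into the top \<open>k\<close> and
    the tail \<open>T\<close>.\<close>
  have "D * a ^ k * (\<Prod>j\<in>?L. 1 + r j) \<le> Determinant.det (1\<^sub>m q + (1 / t) \<cdot>\<^sub>m S_full G r)"
    using det_one_plus_S_trunc_le[OF G q t N r rank K]
    by (simp add: D_def a_def prod.distrib k mult.assoc)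
  also have "\<dots> = (\<Prod>i<q. 1 + ?d i / t)"
    using det_one_plus_smult_eig_desc[OF S_full_carrier[OF G] transpose_S_full, of "1 / t"] by simp
  also have "\<dots> = (\<Prod>i<k. 1 + ?d i / t) * T"
    unfolding T_def using prod.atLeastLessThan_concat[of 0 k q "\<lambda>i. 1 + ?d i / t"] kq
    by (simp add: atLeast0LessThan)
  also have "\<dots> \<le> (b ^ k * (\<Prod>j\<in>?L. 1 + r j)) * T"
  proof (rule mult_right_mono)
    have "0 \<le> K" using assms(6) K by simp
    from prod_eig_desc_S_full_le[where r = r and K = K, OF G r t this] kq
    show "(\<Prod>i<k. 1 + ?d i / t) \<le> b ^ k * (\<Prod>j\<in>?L. 1 + r j)"
      by (simp add: k b_def prod.distrib)
    show "0 \<le> T" using T by simp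
  qed
  finally have "(D * a ^ k) * (\<Prod>j\<in>?L. 1 + r j) \<le> (b ^ k * T) * (\<Prod>j\<in>?L. 1 + r j)"
    by (simp only: mult_ac)
  moreover have "0 < (\<Prod>j\<in>?L. 1 + r j)"
    using r by (intro prod_pos) (auto simp: large_idx_def add_pos_nonneg)
  \<comment> \<open>The same positive product over the weights above \<open>K\<close> stands on both
    sides; cancelling it leaves only the two constants and the power \<open>k\<close>.\<close>
  ultimately have "D * a ^ k \<le> b ^ k * T" by simp
  hence "ln (D * a ^ k) \<le> ln (b ^ k * T)"
    using D a b T by (subst ln_le_cancel_iff) auto
  hence "ln D + real k * ln a \<le> real k * ln b + ln T"
    using D a b T by (simp add: ln_mult_pos ln_realpow)
  hence "ln D - ln T \<le> real k * ln (b / a)"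
    using a b by (simp add: ln_div algebra_simps)
  moreover have "0 \<le> ln D - ln T" using TD T D by simp
  moreover have "real (card (large_idx N r' K)) * ln (sigma_upper G t / sigma_lower G r' t M)
      = real k * ln (sigma_upper G t / sigma_lower G r t M)"
    if "large_idx N r' M = large_idx N r M \<and> card (large_idx N r' K) = k
      \<and> (\<forall>j<N. r j \<le> M \<longrightarrow> r' j = r j)" for r'
    using sigma_lower_cong[of G r' M r t] that G by simp
  ultimately show ?thesis
    unfolding lnT D_def[symmetric] a_def b_def by (intro conjI allI impI)
qed

end
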